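(* Let $m\geqslant 3$, let $B>0$, and for a large positive integer $N$ put $Q=\log^B N$. Fix positive integers $c_1,\dots,c_m$. Let $\delta\in(0,\frac{1}{12m})$ and let $b_1,\dots,b_m\leqslant N^{\delta}$ be positive integers with $b_i=c_i\eta_i$, where each $\eta_i$ is a positive integer all of whose prime divisors exceed $Q$; assume $\gcd(b_1,\dots,b_m)=1$ and in addition $\eta_1=\eta_2=\eta_3=1$. Then \[\int_{\mathfrak{m}}\prod_{i=1}^m S_i(N,\alpha)\,e(-N\alpha)\,d\alpha\ll\frac{1}{b_1\cdots b_m}\,\frac{N^{m-1}}{\log^{\frac{B}{2}-6}N}.\]
   Context: $S_i(N,\alpha)=\sum_{n\leqslant N/b_i}\Lambda(n)e(nb_i\alpha)$, $\Lambda$ the von Mangoldt function, $e(x)=e^{2\pi ix}$. Major arcs: for $q\leqslant Q$, $1\leqslant a\leqslant q$, $(a,q)=1$, $\mathcal{M}_{a,q}=\{\alpha\in\mathbf{R}/\mathbf{Z}:\|\alpha-a/q\|_{\mathbf{R}/\mathbf{Z}}\leqslant Q/N\}$; $\mathcal{M}$ is their union and $\mathfrak{m}=(\mathbf{R}/\mathbf{Z})\setminus\mathcal{M}$. Implied constant independent of $N$ and the $\eta_i$ (may depend on $m,c_i,B,\delta$). *)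

theory Defs
  imports "HOL-Analysis.Analysis" "HOL-Number_Theory.Number_Theory"
begin

definition additive_char :: "real \<Rightarrow> complex" where
  "additive_char x = exp (2 * of_real pi * \<i> * of_real x)"

definition exp_sum :: "nat \<Rightarrow> nat \<Rightarrow> real \<Rightarrow> complex" where
  "exp_sum b N \<alpha> =
     (\<Sum>n | 0 < n \<and> real n \<le> real N / real b.
        mangoldt n * additive_char (real n * real b * \<alpha>))"

text \<open>
  The circle \<open>\<real>/\<int>\<close> with its Haar measure is represented by the fundamental domain
  \<open>{0..<1}\<close> with Lebesgue measure, and the distance of \<open>x\<close> to \<open>0\<close> in \<open>\<real>/\<int>\<close>
  is \<open>infdist x \<int>\<close>. In particular the arc around \<open>1/1\<close> wraps around the end points.
\<close>

definition major_arc :: "real \<Rightarrow> nat \<Rightarrow> nat \<Rightarrow> nat \<Rightarrow> real set" where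
  "major_arc Q N a q =
     {\<alpha> \<in> {0..<1}. infdist (\<alpha> - real a / real q) \<int> \<le> Q / real N}"

definition major_arcs :: "real \<Rightarrow> nat \<Rightarrow> real set" where
  "major_arcs Q N =
     \<Union> {major_arc Q N a q | a q. real q \<le> Q \<and> 1 \<le> a \<and> a \<le> q \<and> coprime a q}"

definition minor_arcs :: "real \<Rightarrow> nat \<Rightarrow> real set" where
  "minor_arcs Q N = {0..<1} - major_arcs Q N"

text \<open>
  The Bochner integral of a non-integrable function is \<open>0\<close>; the next facts show that
  the minor arc integrals are genuine.
\<close>

lemma minor_arcs_measurable: "minor_arcs Q N \<in> sets borel"
proof -
  let ?I = "{(a, q). real q \<le> Q \<and> 1 \<le> a \<and> a \<le> q \<and> coprime a q}"
  have eq: "major_arcs Q N = (\<Union>(a, q)\<in>?I. major_arc Q N a q)"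
    unfolding major_arcs_def by auto
  have "major_arc Q N a q \<in> sets borel" for a q
  proof -
    have "closed {\<alpha>::real. infdist (\<alpha> - real a / real q) \<int> \<le> Q / real N}"
      by (intro closed_Collect_le continuous_intros)
    moreover have "major_arc Q N a q =
        {0..<1} \<inter> {\<alpha>. infdist (\<alpha> - real a / real q) \<int> \<le> Q / real N}"
      unfolding major_arc_def by auto
    ultimately show ?thesis by (simp add: borel_closed sets.Int)
  qed
  then have "major_arcs Q N \<in> sets borel"
    unfolding eq by (intro sets.countable_UN') auto
  then show ?thesis unfolding minor_arcs_def by auto
qed

lemma continuous_additive_char [continuous_intros]:
  "continuous_on A f \<Longrightarrow> continuous_on A (\<lambda>x. additive_char (f x))"
  unfolding additive_char_def by (intro continuous_intros)

lemma continuous_exp_sum [continuous_intros]: "continuous_on A (exp_sum b N)"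
  unfolding exp_sum_def by (intro continuous_intros)

lemma minor_arc_integrand_integrable:
  "set_integrable lborel (minor_arcs Q N)
     (\<lambda>\<alpha>. (\<Prod>i=1..m. exp_sum (b i) N \<alpha>) * additive_char (- real N * \<alpha>))"
proof (rule set_integrable_subset)
  show "set_integrable lborel {0..1}
     (\<lambda>\<alpha>. (\<Prod>i=1..m. exp_sum (b i) N \<alpha>) * additive_char (- real N * \<alpha>))"
    unfolding set_integrable_def
    by (intro borel_integrable_compact continuous_intros compact_Icc)
qed (auto simp: minor_arcs_measurable, auto simp: minor_arcs_def)

end

theory Submission
  imports Defs "HOL-Computational_Algebra.Squarefree" "HOL-Real_Asymp.Real_Asymp"
begin

text \<open>
  Since \<open>\<eta>\<^sub>1 = \<eta>\<^sub>2 = \<eta>\<^sub>3 = 1\<close>, the sums \<open>S\<^sub>1\<close>, \<open>S\<^sub>2\<close>, \<open>S\<^sub>3\<close> have bounded \<open>b\<^sub>i\<close>. Chebyshev's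
  bound gives \<open>S\<^sub>i \<lesssim> N / b\<^sub>i\<close> for \<open>i \<ge> 4\<close>, and Parseval bounds the mean square of \<open>S\<^sub>2\<close> and \<open>S\<^sub>3\<close>
  by \<open>N log\<^sup>2 N\<close>. It remains to show \<open>S\<^sub>1 \<lesssim> N Q\<^sup>-\<^sup>1\<^sup>/\<^sup>2 log\<^sup>4 N\<close> uniformly on the minor arcs. There
  Dirichlet's theorem yields \<open>|c\<^sub>1 \<alpha> - a / q| \<le> 1 / q\<^sup>2\<close> with \<open>Q / c\<^sub>1 < q \<le> 2 N / Q\<close>, and Vaughan's
  identity with both cut-offs \<open>U \<approx> Q\<close> splits the sum into type I sums, bounded by
  \<open>(N / q + U\<^sup>2 + q) log\<^sup>2 N\<close>, and a type II sum, bounded after a dyadic decomposition and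
  Cauchy--Schwarz by \<open>(N / \<surd>q + N / \<surd>U + \<surd>(N q)) log\<^sup>4 N\<close>.
\<close>

section \<open>Distance to the integers and geometric sums\<close>

text \<open>Pointwise bounds for all \<open>m\<close> factors lose a full power of N, since the
  target is N^(m-1) and not N^m. Two factors in mean square cost N instead of N^2; the whole
  logarithmic saving must then come from one remaining factor, uniformly in \<alpha>. The count is 4
  + 2 = 6 logarithms against sqrt Q = log^(B/2) N. The arcs are defined for \<alpha>, but S_1 is a
  sum over primes at frequency c_1 \<alpha>. A fraction a/q near c_1 \<alpha> gives a/(c_1 q) near
  \<alpha>, so a minor arc only forces c_1 q > Q. This is how c_1 enters the constants, and \<eta>_1
  = 1 keeps it fixed. All arcs have half-width Q/N whatever their denominator, so Dirichlet's
  theorem with denominators up to about N/Q is precise enough. The cut-off U near Q is a balance: N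
  / sqrt U then matches N / sqrt q for the smallest possible q, while U^2 is still only a power of
  log N.\<close>

definition int_dist :: "real \<Rightarrow> real" where
  "int_dist x = \<bar>x - of_int (round x)\<bar>"

lemma int_dist_nonneg: "0 \<le> int_dist x"
  by (simp add: int_dist_def)

lemma int_dist_le: "int_dist x \<le> \<bar>x - of_int n\<bar>"
  unfolding int_dist_def by (rule round_diff_minimal)

lemma int_dist_le_half: "int_dist x \<le> 1 / 2"
  unfolding int_dist_def using of_int_round_abs_le[of x] by (simp add: abs_minus_commute)

lemma int_dist_minus: "int_dist (- x) = int_dist x"
proof -
  have "int_dist (- x) \<le> int_dist x" for x
    using int_dist_le[of "- x" "- round x"] by (simp add: int_dist_def)
  from this[of x] this[of "- x"] show ?thesis by simp
qed

text \<open>The rounded integer is at most \<open>n\<close> or at least \<open>n + 1\<close>, and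
  the offset \<open>y\<close> stays \<open>u\<close> away from both. This converts a location modulo
  1 into a lower bound for the distance.\<close>

lemma int_dist_ge:
  assumes "u \<le> y" "y \<le> 1 - u" "x = of_int n + y"
  shows "u \<le> int_dist x"
proof -
  consider "round x \<le> n" | "round x \<ge> n + 1" by linarith
  then show ?thesis
  proof cases
    case 1
    then have "real_of_int (round x) \<le> of_int n" by simp
    then show ?thesis using assms unfolding int_dist_def by linarith
  next
    case 2
    then have "real_of_int (round x) \<ge> of_int n + 1" by linarith
    then show ?thesis using assms unfolding int_dist_def by linarith
  qed
qed

lemma additive_char_add: "additive_char (x + y) = additive_char x * additive_char y"
  by (simp add: additive_char_def ring_distribs exp_add)

lemma additive_char_eq_cis: "additive_char x = cis (2 * pi * x)"
  by (simp add: additive_char_def cis_conv_exp mult_ac)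

lemma additive_char_0 [simp]: "additive_char 0 = 1"
  by (simp add: additive_char_def)

lemma norm_additive_char [simp]: "norm (additive_char x) = 1"
  by (simp add: additive_char_eq_cis)

lemma cnj_additive_char: "cnj (additive_char x) = additive_char (- x)"
  by (simp add: additive_char_eq_cis cis_cnj)

lemma additive_char_of_int [simp]: "additive_char (of_int n) = 1"
  by (simp add: additive_char_eq_cis cis_multiple_2pi)

lemma additive_char_of_nat_mult: "additive_char (real n * x) = additive_char x ^ n"
  by (simp add: additive_char_eq_cis Complex.DeMoivre mult_ac)

text \<open>A lossy form of the concavity bound \<open>2 * y \<le> sin (pi * y)\<close>, sufficient
  here: above 1/6 monotonicity already gives 1/2, below it the mean value theorem applies with
  cosine at least 1/2.\<close>

lemma sin_pi_mult_ge:
  fixes y :: real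
  assumes "0 \<le> y" "y \<le> 1 / 2"
  shows "y \<le> sin (pi * y)"
proof (cases "y \<le> 1 / 6")
  case False
  have "sin (pi / 6) \<le> sin (pi * y)"
    using assms False by (intro sin_monotone_2pi_le) (auto simp: field_simps)
  then show ?thesis using assms by (simp add: sin_30)
next
  case True
  show ?thesis
  proof (cases "y = 0")
    case False
    then have pos: "0 < pi * y" using assms by simp
    obtain z where z: "0 < z" "z < pi * y" "sin (pi * y) - sin 0 = (pi * y - 0) * cos z"
      using MVT2[OF pos, of sin cos] by (auto intro: derivative_eq_intros)
    have "cos (pi / 3) \<le> cos z"
    proof (rule cos_monotone_0_pi_le)
      have "pi * y \<le> pi * (1 / 6)" using True by (intro mult_left_mono) auto
      then show "z \<le> pi / 3" using z pi_gt_zero by linarith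
    qed (use z in auto)
    then have "pi * y * (1 / 2) \<le> pi * y * cos z"
      using pos by (intro mult_left_mono) (auto simp: cos_60)
    moreover have "2 * y \<le> pi * y" using pi_ge_two assms by (intro mult_right_mono) auto
    moreover have "sin (pi * y) = pi * y * cos z" using z(3) by simp
    ultimately show ?thesis by linarith
  qed simp
qed

lemma norm_additive_char_minus_1: "2 * int_dist x \<le> norm (additive_char x - 1)"
proof -
  define y where "y = x - of_int (round x)"
  have "additive_char x = additive_char (y + of_int (round x))" by (simp add: y_def)
  also have "\<dots> = additive_char y" by (simp only: additive_char_add additive_char_of_int mult_1_right)
  finally have "additive_char x = exp (\<i> * of_real (2 * pi * y))"
    by (simp add: additive_char_def mult_ac)
  then have "norm (additive_char x - 1) = 2 * \<bar>sin (pi * y)\<bar>"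
    by (simp only: dist_exp_i_1) (simp add: mult_ac)
  moreover have "\<bar>sin (pi * y)\<bar> = \<bar>sin (pi * \<bar>y\<bar>)\<bar>" by (simp add: abs_if)
  moreover have "\<bar>y\<bar> \<le> 1 / 2" using int_dist_le_half[of x] by (simp add: y_def int_dist_def)
  then have "\<bar>y\<bar> \<le> sin (pi * \<bar>y\<bar>)" by (intro sin_pi_mult_ge) auto
  ultimately show ?thesis unfolding int_dist_def y_def[symmetric] by linarith
qed

text \<open>Multiplication by \<open>additive_char x - 1\<close> telescopes the sum to a difference
  of two numbers of norm 1.\<close>

lemma norm_geometric_sum_le:
  "norm (\<Sum>n\<in>{a..<b}. additive_char (real n * x)) * int_dist x \<le> 1"
proof (cases "a \<le> b")
  case True
  let ?z = "additive_char x" and ?S = "\<Sum>n\<in>{a..<b}. additive_char (real n * x)"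
  have "?S * (?z - 1) = (\<Sum>n\<in>{a..<b}. ?z ^ Suc n - ?z ^ n)"
    unfolding additive_char_of_nat_mult sum_distrib_right
    by (intro sum.cong) (auto simp: algebra_simps)
  also have "\<dots> = ?z ^ b - ?z ^ a" using True by (rule sum_Suc_diff')
  finally have "norm ?S * norm (?z - 1) = norm (?z ^ b - ?z ^ a)" by (simp flip: norm_mult)
  also have "\<dots> \<le> 2"
    using norm_triangle_ineq4[of "?z ^ b" "?z ^ a"] by (simp add: norm_power)
  finally have "norm ?S * norm (?z - 1) \<le> 2" .
  moreover have "norm ?S * (2 * int_dist x) \<le> norm ?S * norm (?z - 1)"
    by (intro mult_left_mono norm_additive_char_minus_1) auto
  ultimately show ?thesis by linarith
qed simp

text \<open>Partial summation against nondecreasing weights; it removes the logarithm from the first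
  type I sum.\<close>

lemma abel_summation_bound:
  fixes f :: "nat \<Rightarrow> real" and z :: "nat \<Rightarrow> complex"
  assumes "\<And>n. n \<le> M \<Longrightarrow> norm (\<Sum>k\<in>{1..<Suc n}. z k) \<le> G"
    and "\<And>m n. 1 \<le> m \<Longrightarrow> m \<le> n \<Longrightarrow> f m \<le> f n" and "0 \<le> f 1" and "1 \<le> M"
  shows "norm (\<Sum>n\<in>{1..<Suc M}. of_real (f n) * z n) \<le> 2 * f M * G"
proof -
  define Z where "Z n = (\<Sum>k\<in>{1..<Suc n}. z k)" for n
  have G: "0 \<le> G" using assms(1)[of 0] by simp
  \<comment> \<open>The difference is minus the sum of the increments of \<open>f\<close> times
    \<open>Z\<close>, so the bounds telescope.\<close>
  have *: "norm ((\<Sum>n\<in>{1..<Suc m}. of_real (f n) * z n) - of_real (f m) * Z m) \<le> (f m - f 1) * G"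
    if "1 \<le> m" "m \<le> M" for m
    using that
  proof (induction m rule: nat_induct_at_least)
    case base
    then show ?case by (simp add: Z_def)
  next
    case (Suc m)
    have "(\<Sum>n\<in>{1..<Suc (Suc m)}. of_real (f n) * z n) - of_real (f (Suc m)) * Z (Suc m) =
      ((\<Sum>n\<in>{1..<Suc m}. of_real (f n) * z n) - of_real (f m) * Z m) - of_real (f (Suc m) - f m) * Z m"
      using Suc.hyps by (simp add: Z_def algebra_simps)
    also have "norm \<dots> \<le> (f m - f 1) * G + (f (Suc m) - f m) * G"
    proof (rule order.trans[OF norm_triangle_ineq4 add_mono])
      show "norm (of_real (f (Suc m) - f m) * Z m) \<le> (f (Suc m) - f m) * G"
        unfolding norm_mult norm_of_real using assms(2)[of m "Suc m"] Suc assms(1)[of m]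
        by (intro mult_mono) (auto simp: Z_def)
    qed (use Suc in auto)
    finally show ?case by (simp add: algebra_simps)
  qed
  have "norm (\<Sum>n\<in>{1..<Suc M}. of_real (f n) * z n)
     \<le> norm ((\<Sum>n\<in>{1..<Suc M}. of_real (f n) * z n) - of_real (f M) * Z M) + norm (of_real (f M) * Z M)"
    by (metis diff_add_cancel norm_triangle_ineq)
  also have "\<dots> \<le> (f M - f 1) * G + f M * G"
  proof (rule add_mono[OF *])
    have "0 \<le> f M" using assms(2)[of 1 M] assms(3,4) by linarith
    then show "norm (of_real (f M) * Z M) \<le> f M * G"
      using assms(1)[of M] by (simp add: norm_mult Z_def mult_left_mono)
  qed (use assms in auto)
  also have "\<dots> \<le> 2 * f M * G" using assms(3) G by (simp add: algebra_simps)
  finally show ?thesis .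
qed

lemma harm_le_ln: "1 \<le> n \<Longrightarrow> harm n \<le> 1 + ln (real n)"
proof (induction n rule: nat_induct_at_least)
  case base
  then show ?case by (simp add: harm_expand)
next
  case (Suc n)
  have "ln (real n / real (Suc n)) \<le> real n / real (Suc n) - 1"
    using Suc.hyps by (intro ln_le_minus_one) auto
  also have "\<dots> = - inverse (real (Suc n))" by (simp add: field_simps)
  finally have "inverse (real (Suc n)) \<le> ln (real (Suc n)) - ln (real n)"
    using Suc.hyps by (simp add: ln_div)
  then show ?case using Suc.IH by (simp add: harm_Suc)
qed

section \<open>Sums over multiples of a well approximable number\<close>

text \<open>
  As \<open>j\<close> runs over a complete residue system, so does \<open>s + j a\<close>, where \<open>s / q\<close> is
  the fraction closest to \<open>k0 \<beta>\<close>, and \<open>(k0 + j) \<beta>\<close> is within \<open>3 / (2 q)\<close> of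
  \<open>(s + j a) / q\<close>. Stating the decay hypothesis as a product avoids the junk value of
  \<open>1 / int_dist x\<close> at integers.
\<close>

lemma block_sum_bound:
  fixes \<beta> Y :: real and a k0 :: int and q :: nat and g :: "nat \<Rightarrow> real"
  assumes q: "q > 0" and cop: "coprime a (int q)"
    and approx: "\<bar>\<beta> - of_int a / real q\<bar> \<le> 1 / (real q)\<^sup>2" and Y: "0 \<le> Y"
    and gY: "\<And>j. j < q \<Longrightarrow> g j \<le> Y"
    and gd: "\<And>j. j < q \<Longrightarrow> g j * int_dist (of_int (k0 + int j) * \<beta>) \<le> 1"
  shows "(\<Sum>j<q. g j) \<le> 5 * Y + 4 * real q * (1 + ln (real q))"
proof -
  define s where "s = round (real q * (of_int k0 * \<beta>))"
  define r where "r j = nat ((s + int j * a) mod int q)" for j :: nat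
  \<comment> \<open>Five residues near 0 modulo \<open>q\<close> get the trivial bound
    \<open>Y\<close>. Elsewhere the distance to the integers is at least min(n, q - n) / (2 q), and
    the larger of the two reciprocals is majorised by their sum.\<close>
  define w where "w n = (if n \<in> {0, 1, 2, q - 1, q - 2} then Y else 0)
    + (2 * real q / real n + 2 * real q / real (q - n))" for n :: nat
  have r_less: "r j < q" for j using q by (simp add: r_def nat_less_iff)
  have "inj_on r {..<q}"
  proof (rule inj_onI)
    fix i j assume ij: "i \<in> {..<q}" "j \<in> {..<q}" "r i = r j"
    have "(s + int i * a) mod int q = (s + int j * a) mod int q"
      using ij(3) q unfolding r_def by (subst (asm) eq_nat_nat_iff) auto
    then have "int q dvd (s + int i * a) - (s + int j * a)" by (rule mod_eq_dvd_iff[THEN iffD1])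
    then have "int q dvd (int i - int j) * a" by (simp add: algebra_simps)
    then have "int q dvd int i - int j"
      using cop by (simp add: coprime_commute coprime_dvd_mult_left_iff)
    moreover have "\<bar>int i - int j\<bar> < int q" using ij by auto
    ultimately have "int i - int j = 0" by (metis dvd_imp_le_int abs_of_nat not_less)
    then show "i = j" by simp
  qed
  then have bij: "bij_betw r {..<q} {..<q}"
    using endo_inj_surj[of "{..<q}" r] r_less by (auto simp: bij_betw_def)
  have g_le: "g j \<le> w (r j)" if j: "j < q" for j
  proof (cases "r j \<in> {0, 1, 2, q - 1, q - 2}")
    case True
    then have "g j \<le> Y" using gY j by blast
    then show ?thesis using True by (auto simp: w_def intro!: add_increasing2)
  next
    case False
    define R where "R = real (r j)"
    \<comment> \<open>The total error below is 3/2: 1/2 from rounding \<open>s\<close> and 1 from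
      the drift over \<open>j < q\<close> steps. It is at most half of \<open>R\<close> and of
      \<open>q - R\<close> because both are at least 3, which decides how many residues are
      excluded.\<close>
    have Rb: "3 \<le> R" "R \<le> real q - 3" using False r_less[of j] by (auto simp: R_def)
    define x where "x = of_int (k0 + int j) * \<beta>"
    define y where "y = x - of_int ((s + int j * a) div int q)"
    define u where "u = min R (real q - R) / (2 * real q)"
    have "\<bar>real q * (of_int k0 * \<beta>) - of_int s\<bar> \<le> 1 / 2"
      unfolding s_def using of_int_round_abs_le[of "real q * (of_int k0 * \<beta>)"]
      by (simp add: abs_minus_commute)
    moreover have "\<bar>real j * (real q * \<beta> - of_int a)\<bar> \<le> 1"
    proof -
      have "\<bar>real q * \<beta> - of_int a\<bar> = real q * \<bar>\<beta> - of_int a / real q\<bar>"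
        using q by (simp add: abs_mult_pos' field_simps)
      also have "\<dots> \<le> real q * (1 / (real q)\<^sup>2)" by (intro mult_left_mono approx) auto
      finally have "\<bar>real q * \<beta> - of_int a\<bar> \<le> 1 / real q" using q by (simp add: power2_eq_square)
      then have "real j * \<bar>real q * \<beta> - of_int a\<bar> \<le> real q * (1 / real q)"
        using j by (intro mult_mono) auto
      then show ?thesis using q by (simp add: abs_mult)
    qed
    moreover have "real q * x - of_int (s + int j * a)
      = (real q * (of_int k0 * \<beta>) - of_int s) + real j * (real q * \<beta> - of_int a)"
      by (simp add: x_def algebra_simps)
    ultimately have e1: "\<bar>real q * x - of_int (s + int j * a)\<bar> \<le> 3 / 2" by linarith
    have "s + int j * a = int q * ((s + int j * a) div int q) + int (r j)"
      using q by (simp add: r_def)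
    then have "real_of_int (s + int j * a) = of_int (int q * ((s + int j * a) div int q) + int (r j))"
      by (rule arg_cong)
    then have "real_of_int (s + int j * a) = real q * of_int ((s + int j * a) div int q) + R"
      by (simp add: R_def)
    then have "real q * x - of_int (s + int j * a) = real q * y - R" by (simp add: y_def algebra_simps)
    then have e2: "\<bar>real q * y - R\<bar> \<le> 3 / 2" using e1 by simp
    have "u \<le> int_dist x"
    proof (rule int_dist_ge)
      show "x = of_int ((s + int j * a) div int q) + y" by (simp add: y_def)
      have "real q * u = min R (real q - R) / 2" using q by (simp add: u_def)
      then have qu: "real q * u \<le> R / 2" "real q * u \<le> (real q - R) / 2" by auto
      have "real q * u \<le> real q * y" using qu e2 Rb by linarith
      then show "u \<le> y" using q by simp
      have "real q * y \<le> real q * (1 - u)"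
      proof -
        have "real q * y \<le> R + 3 / 2" using e2 by linarith
        moreover have "A \<le> p - D" if "A \<le> R + 3 / 2" "D \<le> (p - R) / 2" "R \<le> p - 3" for A D p :: real
          using that by (simp add: field_simps)
        ultimately have "real q * y \<le> real q - real q * u" using qu(2) Rb(2) by blast
        then show ?thesis by (simp add: right_diff_distrib)
      qed
      then show "y \<le> 1 - u" using q by simp
    qed
    moreover have "u > 0" using Rb q by (auto simp: u_def)
    moreover have "g j * int_dist x \<le> 1" using gd[OF j] by (simp add: x_def)
    ultimately have "g j \<le> 1 / u"
    proof (cases "g j \<le> 0")
      case False
      then have "g j * u \<le> g j * int_dist x" using \<open>u \<le> int_dist x\<close> by (intro mult_left_mono) auto
      then show ?thesis using \<open>g j * int_dist x \<le> 1\<close> \<open>u > 0\<close> by (simp add: pos_le_divide_eq)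
    qed (use order.trans[of "g j" 0 "1 / u"] in simp)
    also have "\<dots> = 2 * real q / min R (real q - R)" by (simp add: u_def)
    also have "\<dots> \<le> 2 * real q / R + 2 * real q / (real q - R)"
      using Rb by (auto simp: min_def)
    also have "\<dots> \<le> w (r j)"
      using False r_less[of j] by (simp add: w_def R_def of_nat_diff)
    finally show ?thesis .
  qed
  have "(\<Sum>j<q. g j) \<le> (\<Sum>j<q. w (r j))" using g_le by (intro sum_mono) auto
  also have "\<dots> = (\<Sum>n<q. w n)" by (rule sum.reindex_bij_betw[OF bij])
  also have "\<dots> = (\<Sum>n<q. if n \<in> {0, 1, 2, q - 1, q - 2} then Y else 0)
      + ((\<Sum>n<q. 2 * real q / real n) + (\<Sum>n<q. 2 * real q / real (q - n)))"
    by (simp add: w_def sum.distrib)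
  also have "(\<Sum>n<q. if n \<in> {0, 1, 2, q - 1, q - 2} then Y else 0) \<le> 5 * Y"
  proof -
    have "(\<Sum>n<q. if n \<in> {0, 1, 2, q - 1, q - 2} then Y else 0)
       = (\<Sum>n\<in>{..<q} \<inter> {0, 1, 2, q - 1, q - 2}. Y)"
      by (subst sum.inter_restrict) auto
    also have "\<dots> = real (card ({..<q} \<inter> {0, 1, 2, q - 1, q - 2})) * Y" by simp
    also have "\<dots> \<le> real 5 * Y"
    proof (intro mult_right_mono Y of_nat_mono)
      \<comment> \<open>Passing through a list bounds the cardinality without distinctness: for
        small \<open>q\<close> the five residues coincide or are truncated to 0.\<close>
      have "card ({..<q} \<inter> {0, 1, 2, q - 1, q - 2}) \<le> card (set [0, 1, 2, q - 1, q - 2])"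
        by (intro card_mono) auto
      also have "\<dots> \<le> 5" by (rule order.trans[OF card_length]) simp
      finally show "card ({..<q} \<inter> {0, 1, 2, q - 1, q - 2}) \<le> 5" .
    qed
    finally show ?thesis by simp
  qed
  also have "(\<Sum>n<q. 2 * real q / real n) \<le> 2 * real q * harm q"
  proof -
    have "(\<Sum>n<q. 2 * real q / real n) \<le> (\<Sum>n\<in>{0..q}. 2 * real q / real n)"
      by (intro sum_mono2) auto
    \<comment> \<open>The term at \<open>n = 0\<close> is 0 by the convention for division by
      zero.\<close>
    also have "\<dots> = (\<Sum>n\<in>{1..q}. 2 * real q / real n)"
      by (intro sum.mono_neutral_right) (auto simp: not_le)
    finally show ?thesis by (simp add: harm_def sum_distrib_left divide_inverse)
  qed
  also have "(\<Sum>n<q. 2 * real q / real (q - n)) = 2 * real q * harm q"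
    unfolding harm_def sum_distrib_left
    by (rule sum.reindex_bij_witness[of _ "\<lambda>n. q - n" "\<lambda>n. q - n"]) (auto simp: divide_inverse)
  also have "5 * Y + (2 * real q * harm q + 2 * real q * harm q) = 5 * Y + 4 * real q * harm q"
    by simp
  also have "\<dots> \<le> 5 * Y + 4 * real q * (1 + ln (real q))"
    using harm_le_ln[of q] q by (intro add_left_mono mult_left_mono) auto
  finally show ?thesis by (simp add: mult_ac)
qed

text \<open>As \<open>q\<close> does not divide k a, the number k a / q is at least 1/q away from
  every integer, and replacing a/q by \<beta> moves it by at most k / q^2 \<le> 1 / (2 q).\<close>

lemma int_dist_small_multiple:
  fixes \<beta> :: real and a :: int and q k :: nat
  assumes "coprime a (int q)" "\<bar>\<beta> - of_int a / real q\<bar> \<le> 1 / (real q)\<^sup>2" "0 < k" "2 * k \<le> q"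
  shows "1 \<le> 2 * real q * int_dist (real k * \<beta>)"
proof -
  define n where "n = round (real k * \<beta>)"
  have q: "q > 0" using assms by simp
  have "int k * a - n * int q \<noteq> 0"
  proof
    assume "int k * a - n * int q = 0"
    then have "int q dvd int k * a" by simp
    then have "int q dvd int k"
      using assms(1) by (simp add: coprime_commute coprime_dvd_mult_left_iff)
    then show False using assms by (auto dest: dvd_imp_le)
  qed
  then have "1 \<le> \<bar>int k * a - n * int q\<bar>" by linarith
  then have "1 \<le> \<bar>real_of_int (int k * a - n * int q)\<bar>" by linarith
  then have 1: "1 \<le> \<bar>real k * of_int a - of_int n * real q\<bar>" by simp
  have "\<bar>real q * \<beta> - of_int a\<bar> = real q * \<bar>\<beta> - of_int a / real q\<bar>"
    using q by (simp add: abs_mult_pos' field_simps)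
  also have "\<dots> \<le> real q * (1 / (real q)\<^sup>2)" by (intro mult_left_mono assms) auto
  finally have "\<bar>real q * \<beta> - of_int a\<bar> \<le> 1 / real q" using q by (simp add: power2_eq_square)
  then have "real k * \<bar>real q * \<beta> - of_int a\<bar> \<le> real q / 2 * (1 / real q)"
    using assms by (intro mult_mono) auto
  then have 2: "\<bar>real k * (real q * \<beta> - of_int a)\<bar> \<le> 1 / 2" using q by (simp add: abs_mult)
  have "real q * (real k * \<beta> - of_int n) =
      (real k * of_int a - of_int n * real q) + real k * (real q * \<beta> - of_int a)"
    by (simp add: algebra_simps)
  then have "1 / 2 \<le> \<bar>real q * (real k * \<beta> - of_int n)\<bar>" using 1 2 by linarith
  then show ?thesis by (simp add: int_dist_def n_def abs_mult)
qed

lemma sum_lessThan_mult_blocks: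
  fixes f :: "nat \<Rightarrow> real"
  shows "(\<Sum>k<H * q. f k) = (\<Sum>h<H. \<Sum>j<q. f (h * q + j))"
proof (induction H)
  case (Suc H)
  have "(\<Sum>k<Suc H * q. f k) = (\<Sum>k<H * q. f k) + (\<Sum>k\<in>{H * q..<H * q + q}. f k)"
    using sum.atLeastLessThan_concat[of 0 "H * q" "H * q + q" f]
    by (simp add: lessThan_atLeast0 add.commute)
  also have "(\<Sum>k\<in>{H * q..<H * q + q}. f k) = (\<Sum>j<q. f (H * q + j))"
    using sum.shift_bounds_nat_ivl[of f 0 "H * q" q] by (simp add: lessThan_atLeast0 add.commute)
  finally show ?case using Suc.IH by simp
qed simp

text \<open>Each block of \<open>q\<close> consecutive \<open>k\<close> runs through all residues
  once. In block \<open>h\<close> the bound X/k is of size X / ((h + 1) q), so these parts add up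
  harmonically, while the decay costs q log q in each of about K/q + 1 blocks.\<close>

lemma type_I_sum_bound:
  fixes \<beta> X L :: real and a :: int and q K :: nat and g :: "nat \<Rightarrow> real"
  assumes q: "q > 0" and cop: "coprime a (int q)"
    and approx: "\<bar>\<beta> - of_int a / real q\<bar> \<le> 1 / (real q)\<^sup>2" and X: "0 \<le> X"
    and L: "1 \<le> L" "ln (real q) \<le> L" "ln (real K + 1) \<le> L"
    and gX: "\<And>k. 1 \<le> k \<Longrightarrow> k \<le> K \<Longrightarrow> g k * real k \<le> X"
    and gd: "\<And>k. 1 \<le> k \<Longrightarrow> k \<le> K \<Longrightarrow> g k * int_dist (real k * \<beta>) \<le> 1"
  shows "(\<Sum>k=1..K. g k) \<le> 20 * L * (X / real q + real K + real q)"
proof -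
  define H where "H = K div q + 1"
  define f where "f k = (if 1 \<le> k \<and> k \<le> K then g k else 0)" for k
  \<comment> \<open>The summand \<open>2 q\<close> absorbs the multiples \<open>k \<le> q / 2\<close>, for which \<open>k \<beta>\<close> stays away from the integers.\<close>
  define Y where "Y h = 2 * X / (real (h + 1) * real q) + 2 * real q" for h :: nat
  have Y0: "0 \<le> Y h" for h using X by (simp add: Y_def)
  have KH: "K < H * q" using q by (simp add: H_def) (metis add.commute dividend_less_div_times)
  have "(\<Sum>k=1..K. g k) = (\<Sum>k=1..K. f k)" by (intro sum.cong) (auto simp: f_def)
  also have "\<dots> = (\<Sum>k<H * q. f k)"
    using KH by (intro sum.mono_neutral_left) (auto simp: f_def)
  also have "\<dots> = (\<Sum>h<H. \<Sum>j<q. f (h * q + j))" by (rule sum_lessThan_mult_blocks)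
  also have "\<dots> \<le> (\<Sum>h<H. 5 * Y h + 4 * real q * (1 + ln (real q)))"
  proof (rule sum_mono, rule block_sum_bound[OF q cop approx Y0])
    fix h j
    show "f (h * q + j) * int_dist (of_int (int (h * q) + int j) * \<beta>) \<le> 1"
      using gd[of "h * q + j"] by (auto simp: f_def)
    show "f (h * q + j) \<le> Y h"
    proof (cases "1 \<le> h * q + j \<and> h * q + j \<le> K")
      case True
      define k where "k = h * q + j"
      have fk: "f k = g k" "1 \<le> k" "k \<le> K" using True by (auto simp: f_def k_def)
      show ?thesis
      proof (cases "2 * k \<le> q")
        case T: True
        have 1: "1 \<le> 2 * real q * int_dist (real k * \<beta>)"
          using int_dist_small_multiple[OF cop approx, of k] T fk by simp
        then have "int_dist (real k * \<beta>) > 0"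
          using int_dist_nonneg[of "real k * \<beta>"] by (cases "int_dist (real k * \<beta>) = 0") auto
        moreover have "g k * int_dist (real k * \<beta>) \<le> 2 * real q * int_dist (real k * \<beta>)"
          using gd[of k] fk 1 by linarith
        ultimately have "g k \<le> 2 * real q" by simp
        then show ?thesis using fk X q by (simp add: Y_def k_def[symmetric] add_increasing)
      next
        case False
        \<comment> \<open>For \<open>h = 0\<close> this is the case assumption; for later blocks
          \<open>h * q \<le> k\<close> and \<open>h + 1 \<le> 2 * h\<close>.\<close>
        have "(h + 1) * q \<le> 2 * k"
        proof (cases "h = 0")
          case False
          define t where "t = h * q"
          have "q \<le> t" using False by (simp add: t_def)
          then have "t + q \<le> 2 * (t + j)" by simp
          moreover have "(h + 1) * q = t + q" by (simp add: t_def)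
          ultimately show ?thesis by (simp only: k_def t_def[symmetric])
        qed (use \<open>\<not> 2 * k \<le> q\<close> in simp)
        then have "real ((h + 1) * q) \<le> real (2 * k)" by (rule of_nat_mono)
        then have k2: "real (h + 1) * real q \<le> 2 * real k" by (simp only: of_nat_mult of_nat_numeral)
        have "g k \<le> X / real k" using gX fk by (simp add: field_simps)
        also have "\<dots> = 2 * X / (2 * real k)" by simp
        also have "\<dots> \<le> 2 * X / (real (h + 1) * real q)"
          using k2 X q fk by (intro divide_left_mono mult_pos_pos) auto
        finally show ?thesis using fk by (simp add: Y_def k_def[symmetric])
      qed
    qed (use Y0 in \<open>auto simp: f_def\<close>)
  qed
  also have "\<dots> = 10 * X / real q * harm H + real H * (10 * real q + 4 * real q * (1 + ln (real q)))"
  proof -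
    have "(\<Sum>h<H. 10 * X / (real (h + 1) * real q)) = 10 * X / real q * harm H"
      unfolding harm_altdef sum_distrib_left by (intro sum.cong) (auto simp: field_simps)
    then show ?thesis
      by (simp add: Y_def sum.distrib sum_distrib_left algebra_simps)
  qed
  also have "\<dots> \<le> 10 * X / real q * (2 * L) + 18 * L * (real K + real q)"
  proof (intro add_mono mult_left_mono)
    have "H \<le> K + 1" by (simp add: H_def)
    then have "ln (real H) \<le> ln (real K + 1)" by (subst ln_le_cancel_iff) (auto simp: H_def)
    moreover have "1 \<le> H" by (simp add: H_def)
    ultimately show "harm H \<le> 2 * L" using harm_le_ln[of H] L by linarith
    have "real (K div q) * real q \<le> real K" by (metis div_times_less_eq_dividend of_nat_le_iff of_nat_mult)
    then have Hq: "real H * real q \<le> real K + real q" by (simp add: H_def algebra_simps)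
    have "10 * real q + 4 * real q * (1 + ln (real q)) \<le> 10 * real q * L + 4 * real q * (L + L)"
    proof (intro add_mono mult_left_mono)
      show "10 * real q \<le> 10 * real q * L" using mult_left_mono[OF L(1), of "10 * real q"] by simp
    qed (use L in auto)
    then have "real H * (10 * real q + 4 * real q * (1 + ln (real q))) \<le> real H * (18 * L * real q)"
      by (intro mult_left_mono) (auto simp: algebra_simps)
    also have "\<dots> = 18 * L * (real H * real q)" by simp
    also have "\<dots> \<le> 18 * L * (real K + real q)" using Hq L by (intro mult_left_mono) auto
    finally show "real H * (10 * real q + 4 * real q * (1 + ln (real q))) \<le> 18 * L * (real K + real q)" .
  qed (use X q in auto)
  also have "\<dots> \<le> 20 * L * (X / real q + real K + real q)"
  proof -
    have "0 \<le> 2 * L * (real K + real q)" using L by simp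
    then show ?thesis by (simp add: algebra_simps)
  qed
  finally show ?thesis .
qed

text \<open>The variant with a flat bound \<open>Y\<close> and an arbitrary shift \<open>s\<close>,
  so that every block costs the same. It serves for the rows of a correlation matrix, whose entries
  depend on differences of indices.\<close>

lemma shifted_sum_bound:
  fixes \<beta> Y :: real and a s :: int and q K :: nat and g :: "nat \<Rightarrow> real"
  assumes q: "q > 0" and cop: "coprime a (int q)"
    and approx: "\<bar>\<beta> - of_int a / real q\<bar> \<le> 1 / (real q)\<^sup>2" and Y: "0 \<le> Y"
    and gY: "\<And>k. k \<in> {1..K} \<Longrightarrow> g k \<le> Y"
    and gd: "\<And>k. k \<in> {1..K} \<Longrightarrow> g k * int_dist (of_int (int k - s) * \<beta>) \<le> 1"
  shows "(\<Sum>k=1..K. g k) \<le> (real K / real q + 1) * (5 * Y + 4 * real q * (1 + ln (real q)))"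
proof -
  define H where "H = K div q + 1"
  define f where "f k = (if k \<in> {1..K} then g k else 0)" for k
  let ?Z = "5 * Y + 4 * real q * (1 + ln (real q))"
  have Z: "0 \<le> ?Z" using q Y by (intro add_nonneg_nonneg mult_nonneg_nonneg ln_ge_zero) auto
  have KH: "K < H * q" using q by (simp add: H_def) (metis add.commute dividend_less_div_times)
  have "(\<Sum>k=1..K. g k) = (\<Sum>k=1..K. f k)" by (intro sum.cong) (auto simp: f_def)
  also have "\<dots> = (\<Sum>k<H * q. f k)"
    using KH by (intro sum.mono_neutral_left) (auto simp: f_def)
  also have "\<dots> = (\<Sum>h<H. \<Sum>j<q. f (h * q + j))" by (rule sum_lessThan_mult_blocks)
  also have "\<dots> \<le> (\<Sum>h<H. ?Z)"
  proof (rule sum_mono, rule block_sum_bound[OF q cop approx Y])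
    fix h j
    show "f (h * q + j) \<le> Y" using gY Y by (auto simp: f_def)
    have eq: "int (h * q) - s + int j = int (h * q + j) - s" by simp
    show "f (h * q + j) * int_dist (of_int (int (h * q) - s + int j) * \<beta>) \<le> 1"
      unfolding f_def eq using gd[of "h * q + j"] by auto
  qed
  also have "\<dots> = real H * ?Z" by simp
  also have "\<dots> \<le> (real K / real q + 1) * ?Z"
    using of_nat_div_le_of_nat[of K q] by (intro mult_right_mono Z) (simp add: H_def)
  finally show ?thesis .
qed

section \<open>Arithmetic functions and Vaughan's identity\<close>

text \<open>The cut-off sits in \<open>f\<close> and not in the ranges: terms with d l > X vanish,
  so the square shrinks to the hyperbola region and can be reindexed by k = d l. All convolutions
  below can thus run over \<open>{1..X}\<close>.\<close>

lemma sum_mult_regroup: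
  fixes g :: "nat \<Rightarrow> nat \<Rightarrow> 'a :: comm_ring_1" and f :: "nat \<Rightarrow> 'a"
  assumes "\<And>k. X < k \<Longrightarrow> f k = 0"
  shows "(\<Sum>d=1..X. \<Sum>l=1..X. g d l * f (d * l)) = (\<Sum>k=1..X. (\<Sum>d | d dvd k. g d (k div d)) * f k)"
proof -
  have "(\<Sum>d=1..X. \<Sum>l=1..X. g d l * f (d * l)) = (\<Sum>(d, l)\<in>{1..X} \<times> {1..X}. g d l * f (d * l))"
    by (rule sum.cartesian_product)
  also have "\<dots> = (\<Sum>(d, l)\<in>{(d, l). d \<in> {1..X} \<and> l \<in> {1..X} \<and> d * l \<le> X}. g d l * f (d * l))"
  proof (rule sum.mono_neutral_right)
    show "\<forall>i\<in>{1..X} \<times> {1..X} - {(d, l). d \<in> {1..X} \<and> l \<in> {1..X} \<and> d * l \<le> X}.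
        (case i of (d, l) \<Rightarrow> g d l * f (d * l)) = 0"
      using assms by (auto simp: not_le) (metis mult_zero_right not_le)
  qed auto
  also have "\<dots> = (\<Sum>(k, d)\<in>(SIGMA k:{1..X}. {d. d dvd k}). g d (k div d) * f k)"
  proof (rule sum.reindex_bij_witness[of _ "\<lambda>(k, d). (d, k div d)" "\<lambda>(d, l). (d * l, d)"])
    fix b assume "b \<in> (SIGMA k:{1..X}. {d. d dvd k})"
    then obtain k d where b: "b = (k, d)" "1 \<le> k" "k \<le> X" "d dvd k" by auto
    then obtain l where "k = d * l" by auto
    then show "(case b of (k, d) \<Rightarrow> (d, k div d)) \<in> {(d, l). d \<in> {1..X} \<and> l \<in> {1..X} \<and> d * l \<le> X}"
      using b by (auto intro: order.trans[rotated])
  qed auto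
  also have "\<dots> = (\<Sum>k=1..X. \<Sum>d | d dvd k. g d (k div d) * f k)"
    by (rule sum.Sigma[symmetric]) (auto intro: finite_divisors_nat)
  finally show ?thesis by (simp add: sum_distrib_right)
qed

section \<open>The Moebius function\<close>

definition moebius :: "nat \<Rightarrow> real" where
  "moebius n = (if squarefree n then (- 1) ^ card (prime_factors n) else 0)"

lemma abs_moebius_le: "\<bar>moebius n\<bar> \<le> 1"
  by (simp add: moebius_def power_abs)

lemma moebius_prime_mult:
  assumes "prime p" "\<not> p dvd n"
  shows "moebius (p * n) = - moebius n"
proof -
  have "n \<noteq> 0" "p \<noteq> 0" using assms by (auto intro!: Nat.gr0I)
  have "coprime p n" using assms by (simp add: prime_imp_coprime)
  then have "squarefree (p * n) \<longleftrightarrow> squarefree n"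
    using assms by (auto simp: squarefree_prime dest: squarefree_multD(2) intro: squarefree_mult_coprime)
  moreover have "prime_factors (p * n) = insert p (prime_factors n)"
    using assms \<open>n \<noteq> 0\<close> \<open>p \<noteq> 0\<close> by (simp add: prime_factors_product prime_prime_factors)
  moreover have "p \<notin> prime_factors n" using assms by auto
  ultimately show ?thesis by (simp add: moebius_def)
qed

text \<open>Divisors prime to a fixed prime factor \<open>p\<close> cancel against their multiples
  by \<open>p\<close>; the divisors left over are multiples of p^2 and contribute 0.\<close>

lemma sum_moebius_divisors:
  assumes "0 < n"
  shows "(\<Sum>d | d dvd n. moebius d) = (if n = 1 then 1 else 0)"
proof (cases "n = 1")
  case True
  then show ?thesis by (simp add: moebius_def)
next
  case False
  then obtain p where p: "prime p" "p dvd n" using prime_factor_nat by blast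
  have fin: "finite {d. d dvd n}" using assms by (simp add: finite_divisors_nat)
  have "(\<Sum>d | d dvd n. moebius d) = (\<Sum>d\<in>{d. d dvd n} \<inter> {d. p dvd d}. moebius d)
      + (\<Sum>d\<in>{d. d dvd n} \<inter> - {d. p dvd d}. moebius d)"
    by (rule sum.Int_Diff[OF fin, of _ "{d. p dvd d}", unfolded Diff_eq])
  also have "(\<Sum>d\<in>{d. d dvd n} \<inter> {d. p dvd d}. moebius d)
      = (\<Sum>d\<in>(*) p ` ({d. d dvd n} \<inter> - {d. p dvd d}). moebius d)"
  proof (rule sum.mono_neutral_right)
    show "(*) p ` ({d. d dvd n} \<inter> - {d. p dvd d}) \<subseteq> {d. d dvd n} \<inter> {d. p dvd d}"
      using p by (auto intro!: divides_mult prime_imp_coprime)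
    show "\<forall>i\<in>{d. d dvd n} \<inter> {d. p dvd d} - (*) p ` ({d. d dvd n} \<inter> - {d. p dvd d}). moebius i = 0"
    proof
      fix i assume i: "i \<in> {d. d dvd n} \<inter> {d. p dvd d} - (*) p ` ({d. d dvd n} \<inter> - {d. p dvd d})"
      then obtain e where e: "i = p * e" by auto
      have "e dvd n" using i e by (auto dest: dvd_mult_right)
      then have "p dvd e" using i e by auto
      then have "p ^ 2 dvd i" by (simp add: e power2_eq_square mult_dvd_mono)
      then have "\<not> squarefree i" using p squarefreeD[of i p] by auto
      then show "moebius i = 0" by (simp add: moebius_def)
    qed
  qed (use fin in auto)
  also have "\<dots> = (\<Sum>d\<in>{d. d dvd n} \<inter> - {d. p dvd d}. moebius (p * d))"
    using p by (subst sum.reindex) (auto simp: inj_on_def)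
  also have "\<dots> = (\<Sum>d\<in>{d. d dvd n} \<inter> - {d. p dvd d}. - moebius d)"
    using p by (intro sum.cong) (auto simp: moebius_prime_mult)
  finally show ?thesis using False by (simp add: sum_negf)
qed

section \<open>Chebyshev's bound\<close>

text \<open>Each logarithm is a divisor sum of \<open>mangoldt\<close>, and \<open>d\<close> has
  \<open>n div d\<close> multiples up to \<open>n\<close>. The range \<open>X\<close> is left free
  so that the formulas for n! and (2 n)! can be subtracted term by term.\<close>

lemma ln_fact_eq_sum_mangoldt:
  assumes "n \<le> X"
  shows "ln (fact n :: real) = (\<Sum>d=1..X. mangoldt d * real (n div d))"
proof -
  define f where "f k = (if k \<le> n then 1 else 0 :: real)" for k
  have "ln (fact n :: real) = (\<Sum>k=1..n. ln (real k))"
    by (simp add: fact_prod) (subst ln_prod, auto)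
  also have "\<dots> = (\<Sum>k=1..X. ln (real k) * f k)"
    using assms by (intro sum.mono_neutral_cong_left) (auto simp: f_def)
  also have "\<dots> = (\<Sum>k=1..X. (\<Sum>d | d dvd k. mangoldt d) * f k)"
    by (intro sum.cong) (auto simp: mangoldt_sum)
  also have "\<dots> = (\<Sum>d=1..X. \<Sum>l=1..X. mangoldt d * f (d * l))"
    using assms by (intro sum_mult_regroup[symmetric]) (auto simp: f_def)
  also have "\<dots> = (\<Sum>d=1..X. mangoldt d * real (n div d))"
  proof (intro sum.cong refl)
    fix d assume d: "d \<in> {1..X}"
    have "(\<Sum>l=1..X. f (d * l)) = (\<Sum>l\<in>{1..n div d}. 1)"
    proof (rule sum.mono_neutral_cong_right)
      show "{1..n div d} \<subseteq> {1..X}" using order.trans[OF div_le_dividend[of n d] assms] by auto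
      show "\<forall>i\<in>{1..X} - {1..n div d}. f (d * i) = 0"
        using d by (auto simp: f_def less_eq_div_iff_mult_less_eq mult.commute)
      show "f (d * l) = 1" if "l \<in> {1..n div d}" for l
        using that d by (auto simp: f_def less_eq_div_iff_mult_less_eq mult.commute)
    qed auto
    then show "(\<Sum>l=1..X. mangoldt d * f (d * l)) = mangoldt d * real (n div d)"
      by (simp flip: sum_distrib_left)
  qed
  finally show ?thesis .
qed

text \<open>Legendre's formula turns the difference into a partial sum for \<open>ln (2 n choose n)\<close>.\<close>

lemma sum_mangoldt_dyadic_le:
  "(\<Sum>d=1..2 * n. mangoldt d :: real) \<le> (\<Sum>d=1..n. mangoldt d) + 2 * real n"
proof -
  have le: "2 * (n div d) \<le> 2 * n div d" for d :: nat
    by (cases "d = 0") (simp_all add: less_eq_div_iff_mult_less_eq mult.assoc)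
  have "(\<Sum>d=1..2 * n. mangoldt d :: real) - (\<Sum>d=1..n. mangoldt d)
      = (\<Sum>d\<in>{1..2 * n} - {1..n}. mangoldt d)"
    by (subst sum_diff) auto
  \<comment> \<open>The weight is at least 1 for n < d \<le> 2 n and never negative, so it can be
    inserted here and the sum then extended to all \<open>d\<close>.\<close>
  also have "\<dots> \<le> (\<Sum>d\<in>{1..2 * n} - {1..n}. mangoldt d * (real (2 * n div d) - 2 * real (n div d)))"
  proof (rule sum_mono)
    fix d assume "d \<in> {1..2 * n} - {1..n}"
    then have d: "n < d" "d \<le> 2 * n" by auto
    then have "1 \<le> 2 * n div d" "n div d = 0" by (auto simp: less_eq_div_iff_mult_less_eq)
    then have "1 \<le> real (2 * n div d) - 2 * real (n div d)" by simp
    then show "mangoldt d \<le> mangoldt d * (real (2 * n div d) - 2 * real (n div d))"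
      using mult_left_mono[OF _ mangoldt_nonneg] by fastforce
  qed
  also have "\<dots> \<le> (\<Sum>d=1..2 * n. mangoldt d * (real (2 * n div d) - 2 * real (n div d)))"
  proof (rule sum_mono2)
    fix d :: nat
    have "2 * real (n div d) \<le> real (2 * n div d)" using le[of d] by linarith
    then show "0 \<le> mangoldt d * (real (2 * n div d) - 2 * real (n div d))"
      using mangoldt_nonneg by simp
  qed auto
  also have "\<dots> = ln (fact (2 * n)) - 2 * ln (fact n)"
    by (subst (1 2) ln_fact_eq_sum_mangoldt[of _ "2 * n"])
      (auto simp: sum_subtractf sum_distrib_left algebra_simps)
  also have "\<dots> = ln (fact (2 * n) / (fact n * fact n))"
    by (simp add: ln_div ln_mult)
  also have "fact (2 * n) / (fact n * fact n) = real (2 * n choose n)"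
    by (subst binomial_fact) auto
  also have "ln \<dots> \<le> ln (2 ^ (2 * n))"
  proof -
    have "2 * n choose n \<le> 2 ^ (2 * n)" by (rule binomial_le_pow2)
    then have "real (2 * n choose n) \<le> real (2 ^ (2 * n))" by (rule of_nat_mono)
    then show ?thesis by (subst ln_le_cancel_iff) auto
  qed
  also have "\<dots> = 2 * real n * ln 2" by (simp add: ln_realpow)
  also have "\<dots> \<le> 2 * real n * 1" using ln_2_less_1 by (intro mult_left_mono) auto
  finally show ?thesis by simp
qed

text \<open>Halving with k = ceil(n/2) gives 6 k + 2 k \<le> 4 (n + 1), which is at most 6 n once n
  \<ge> 2; hence the constant 6.\<close>

lemma sum_mangoldt_le: "(\<Sum>d=1..n. mangoldt d :: real) \<le> 6 * real n"
proof (induction n rule: less_induct)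
  case (less n)
  consider "n = 0" | "n = 1" | "2 \<le> n" by linarith
  then show ?case
  proof cases
    case 3
    define k where "k = (n + 1) div 2"
    have k: "k < n" "n \<le> 2 * k" "2 * k \<le> n + 1" using 3 by (auto simp: k_def)
    have "(\<Sum>d=1..n. mangoldt d :: real) \<le> (\<Sum>d=1..2 * k. mangoldt d)"
      using k mangoldt_nonneg by (intro sum_mono2) auto
    also have "\<dots> \<le> 6 * real k + 2 * real k"
      using sum_mangoldt_dyadic_le[of k] less.IH[OF k(1)] by linarith
    also have "\<dots> \<le> 4 * (real n + 1)" using k(3) by simp
    also have "\<dots> \<le> 6 * real n" using 3 by simp
    finally show ?thesis .
  qed auto
qed

section \<open>Mean square of the divisor function\<close>

text \<open>The square counts pairs of divisors, and a pair (a, b) occurs for at most Y gcd(a, b) /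
  (a b) numbers. Pulling out the gcd majorises the sum over pairs by three harmonic sums. The result
  controls the type II coefficients, which are known only to be bounded by the divisor
  count.\<close>

lemma sum_divisor_count_squared_le:
  assumes "1 \<le> Y"
  shows "(\<Sum>n=1..Y. (real (card {d. d dvd n}))\<^sup>2) \<le> real Y * (1 + ln (real Y)) ^ 3"
proof -
  let ?I = "{1..Y}"
  define ind where "ind a n = (if a dvd n then 1 else 0 :: real)" for a n :: nat
  have card_eq: "real (card {d. d dvd n}) = (\<Sum>a\<in>?I. ind a n)" if "n \<in> ?I" for n
  proof -
    have "{d. d dvd n} = ?I \<inter> {a. a dvd n}"
    proof -
      have "1 \<le> x \<and> x \<le> Y" if "x dvd n" for x
        using dvd_imp_le[OF that] dvd_pos_nat[OF _ that] \<open>n \<in> ?I\<close> by auto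
      then show ?thesis by auto
    qed
    then show ?thesis by (simp add: ind_def sum.If_cases)
  qed
  have count: "(\<Sum>n\<in>?I. ind a n * ind b n) \<le> real Y * (real (gcd a b) / (real a * real b))"
    if ab: "a \<in> ?I" "b \<in> ?I" for a b
  proof -
    have l: "lcm a b > 0" using ab by (auto simp: lcm_pos_nat)
    have "(\<Sum>n\<in>?I. ind a n * ind b n) = (\<Sum>n\<in>{n \<in> ?I. lcm a b dvd n}. 1)"
      by (rule sum.mono_neutral_cong_right) (auto simp: ind_def)
    also have "\<dots> \<le> real (card {1..Y div lcm a b})"
    proof -
      have "{n \<in> ?I. lcm a b dvd n} \<subseteq> (*) (lcm a b) ` {1..Y div lcm a b}"
      proof
        fix n assume "n \<in> {n \<in> ?I. lcm a b dvd n}"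
        then have n: "lcm a b dvd n" "1 \<le> n" "n \<le> Y" by auto
        then obtain k where k: "n = lcm a b * k" "1 \<le> n" "n \<le> Y" by (metis dvdE)
        then have "1 \<le> k" by (cases k) auto
        moreover have "k \<le> Y div lcm a b" using k l by (simp add: less_eq_div_iff_mult_less_eq mult.commute)
        ultimately show "n \<in> (*) (lcm a b) ` {1..Y div lcm a b}" using k by auto
      qed
      then have "card {n \<in> ?I. lcm a b dvd n} \<le> card ((*) (lcm a b) ` {1..Y div lcm a b})"
        by (intro card_mono) auto
      also have "\<dots> \<le> card {1..Y div lcm a b}" by (rule card_image_le) simp
      finally show ?thesis by simp
    qed
    also have "\<dots> \<le> real Y / real (lcm a b)" by (simp add: of_nat_div_le_of_nat)
    also have "\<dots> = real Y * (real (gcd a b) / (real a * real b))"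
    proof -
      have "gcd a b * lcm a b = a * b" by (rule prod_gcd_lcm_nat[symmetric])
      then have "real (gcd a b) * real (lcm a b) = real a * real b" by (metis of_nat_mult)
      then show ?thesis using l ab by (simp add: field_simps)
    qed
    finally show ?thesis .
  qed
  have "(\<Sum>n\<in>?I. (real (card {d. d dvd n}))\<^sup>2) = (\<Sum>n\<in>?I. \<Sum>a\<in>?I. \<Sum>b\<in>?I. ind a n * ind b n)"
    by (intro sum.cong) (auto simp: card_eq power2_eq_square sum_product)
  also have "\<dots> = (\<Sum>a\<in>?I. \<Sum>b\<in>?I. \<Sum>n\<in>?I. ind a n * ind b n)"
    by (subst sum.swap, rule sum.cong[OF refl], rule sum.swap)
  also have "\<dots> \<le> (\<Sum>a\<in>?I. \<Sum>b\<in>?I. real Y * (real (gcd a b) / (real a * real b)))"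
    by (intro sum_mono count)
  also have "\<dots> = real Y * (\<Sum>(a, b)\<in>?I \<times> ?I. real (gcd a b) / (real a * real b))"
    by (simp add: sum_distrib_left sum.cartesian_product case_prod_unfold)
  \<comment> \<open>Write \<open>a = g a'\<close> and \<open>b = g b'\<close> with \<open>g = gcd a b\<close>.\<close>
  also have "(\<Sum>(a, b)\<in>?I \<times> ?I. real (gcd a b) / (real a * real b))
      \<le> (\<Sum>(g, a, b)\<in>?I \<times> ?I \<times> ?I. 1 / (real g * real a * real b))"
  proof -
    define \<phi> where "\<phi> = (\<lambda>(a, b). (gcd a b, a div gcd a b, b div gcd a b :: nat))"
    have inj: "inj_on \<phi> (?I \<times> ?I)"
    proof (rule inj_on_inverseI[where g = "\<lambda>(g, a, b). (g * a, g * b)"])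
    qed (auto simp: \<phi>_def)
    have "(\<Sum>(a, b)\<in>?I \<times> ?I. real (gcd a b) / (real a * real b))
        = (\<Sum>(g, a, b)\<in>\<phi> ` (?I \<times> ?I). 1 / (real g * real a * real b))"
    proof (subst sum.reindex[OF inj], intro sum.cong refl)
      fix x assume "x \<in> ?I \<times> ?I"
      then obtain a b where x: "x = (a, b)" "0 < a" "0 < b" by auto
      define g where "g = gcd a b"
      have g: "0 < g" using x by (simp add: g_def)
      obtain a' b' where ab: "a = g * a'" "b = g * b'"
        unfolding g_def by (metis gcd_dvd1 gcd_dvd2 dvdE)
      show "(case x of (a, b) \<Rightarrow> real (gcd a b) / (real a * real b))
          = ((\<lambda>(g, a, b). 1 / (real g * real a * real b)) \<circ> \<phi>) x"
        using g by (simp add: x \<phi>_def g_def[symmetric]) (simp add: ab)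
    qed
    \<comment> \<open>The image contains only triples whose last two entries are coprime; the others
      are added at no cost, all terms being nonnegative.\<close>
    also have "\<dots> \<le> (\<Sum>(g, a, b)\<in>?I \<times> ?I \<times> ?I. 1 / (real g * real a * real b))"
    proof (rule sum_mono2)
      show "\<phi> ` (?I \<times> ?I) \<subseteq> ?I \<times> ?I \<times> ?I"
      proof
        fix y assume "y \<in> \<phi> ` (?I \<times> ?I)"
        then obtain a b where y: "y = \<phi> (a, b)" "0 < a" "a \<le> Y" "0 < b" "b \<le> Y" by auto
        have "gcd a b \<le> Y" using y gcd_le1_nat[of a b] by linarith
        moreover have "a div gcd a b \<le> Y" by (rule order.trans[OF div_le_dividend y(3)])
        moreover have "b div gcd a b \<le> Y" by (rule order.trans[OF div_le_dividend y(5)])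
        moreover have "0 < a div gcd a b" "0 < b div gcd a b"
          using y by (auto simp: div_greater_zero_iff gcd_le1_nat gcd_le2_nat)
        ultimately show "y \<in> ?I \<times> ?I \<times> ?I"
          using y by (auto simp: \<phi>_def Suc_le_eq)
      qed
    qed auto
    finally show ?thesis .
  qed
  also have "(\<Sum>(g, a, b)\<in>?I \<times> ?I \<times> ?I. 1 / (real g * real a * real b)) = harm Y ^ 3"
    by (simp add: harm_def power3_eq_cube sum_product sum.cartesian_product' sum_distrib_left
        sum_distrib_right divide_inverse mult_ac)
  also have "harm Y ^ 3 \<le> (1 + ln (real Y)) ^ 3"
    using harm_le_ln[OF assms] by (intro power_mono harm_nonneg)
  finally show ?thesis by (simp add: mult_left_mono)
qed

text \<open>
  The functions \<open>M\<close>, \<open>A\<close>, \<open>A'\<close> are the truncations \<open>\<mu>\<close> to \<open>{1..V}\<close>, \<open>\<Lambda>\<close> to \<open>{1..U}\<close>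
  and \<open>\<Lambda>\<close> to \<open>{U<..}\<close>; in terms of Dirichlet convolution,
  \<open>\<Lambda> = A + M * log - M * A * 1 + A' * h\<close>.
\<close>

lemma vaughan_identity:
  fixes F :: "nat \<Rightarrow> complex" and X U V :: nat
  assumes F: "\<And>k. X < k \<Longrightarrow> F k = 0"
  defines "M \<equiv> \<lambda>d. complex_of_real (if d \<le> V then moebius d else 0)"
    and "A \<equiv> \<lambda>e. complex_of_real (if e \<le> U then mangoldt e else 0)"
    and "A' \<equiv> \<lambda>e. complex_of_real (if U < e then mangoldt e else 0)"
    and "h \<equiv> \<lambda>k. complex_of_real (\<Sum>d | d dvd k. if V < d then moebius d else 0)"
  shows "(\<Sum>n=1..X. mangoldt n * F n) =
      (\<Sum>n=1..X. A n * F n)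
      + (\<Sum>d=1..X. M d * (\<Sum>k=1..X. of_real (ln (real k)) * F (d * k)))
      - (\<Sum>k=1..X. (\<Sum>d | d dvd k. M d * A (k div d)) * (\<Sum>l=1..X. F (k * l)))
      + (\<Sum>e=1..X. A' e * (\<Sum>k=1..X. h k * F (e * k)))"
proof -
  have Fm: "F (e * k) = 0" if "X < k" "1 \<le> e" for e k
  proof -
    have "k \<le> e * k" using that by simp
    then show ?thesis using that by (intro F) linarith
  qed
  have AA: "mangoldt e = A e + A' e" for e by (simp add: A_def A'_def)
  have M_sum: "(\<Sum>d | d dvd k. M d) + h k = (if k = 1 then 1 else 0)" if "0 < k" for k
  proof -
    have "(\<Sum>d | d dvd k. M d) + h k = of_real (\<Sum>d | d dvd k. moebius d)"
      unfolding M_def h_def of_real_sum[symmetric] of_real_add[symmetric] sum.distrib[symmetric]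
      by (intro arg_cong[where f = of_real] sum.cong) auto
    then show ?thesis using that by (simp add: sum_moebius_divisors)
  qed
  \<comment> \<open>The unit of Dirichlet convolution is inserted and then split as \<open>M\<close>
    convolved with 1 plus \<open>h\<close>; the \<open>h\<close> part is the type II sum.\<close>
  have "(\<Sum>e=1..X. A' e * F e) = (\<Sum>e=1..X. A' e * (\<Sum>k=1..X. (if k = 1 then 1 else 0) * F (e * k)))"
  proof (intro sum.cong refl)
    fix e assume e: "e \<in> {1..X}"
    have "(\<Sum>k=1..X. (if k = 1 then 1 else 0) * F (e * k)) = (\<Sum>k=1..X. if k = 1 then F e else 0)"
      by (intro sum.cong) auto
    also have "\<dots> = F e" using e by simp
    finally show "A' e * F e = A' e * (\<Sum>k=1..X. (if k = 1 then 1 else 0) * F (e * k))" by simp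
  qed
  also have "\<dots> = (\<Sum>e=1..X. A' e * ((\<Sum>k=1..X. (\<Sum>d | d dvd k. M d) * F (e * k)) + (\<Sum>k=1..X. h k * F (e * k))))"
    unfolding sum.distrib[symmetric] distrib_right[symmetric]
    by (intro sum.cong refl arg_cong2[where f = "(*)"]) (auto simp: M_sum)
  also have "\<dots> = (\<Sum>e=1..X. A' e * (\<Sum>k=1..X. (\<Sum>d | d dvd k. M d) * F (e * k)))
      + (\<Sum>e=1..X. A' e * (\<Sum>k=1..X. h k * F (e * k)))"
    by (simp add: distrib_left sum.distrib)
  also have "(\<Sum>e=1..X. A' e * (\<Sum>k=1..X. (\<Sum>d | d dvd k. M d) * F (e * k)))
      = (\<Sum>e=1..X. A' e * (\<Sum>d=1..X. \<Sum>l=1..X. M d * F (e * (d * l))))"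
  proof (rule sum.cong[OF refl], rule arg_cong2[where f = "(*)", OF refl])
    fix e assume "e \<in> {1..X}"
    then show "(\<Sum>k=1..X. (\<Sum>d | d dvd k. M d) * F (e * k)) = (\<Sum>d=1..X. \<Sum>l=1..X. M d * F (e * (d * l)))"
      using Fm by (intro sum_mult_regroup[symmetric, where f = "\<lambda>k. F (e * k)"]) auto
  qed
  also have "\<dots> = (\<Sum>d=1..X. M d * (\<Sum>e=1..X. \<Sum>l=1..X. A' e * F (d * (e * l))))"
    unfolding sum_distrib_left
    by (subst sum.swap, intro sum.cong refl) (simp add: mult_ac)
  \<comment> \<open>Now \<open>A'\<close> is \<open>mangoldt\<close> minus \<open>A\<close>: the
    full function convolved with 1 is the logarithm, the short one gives the second type I
    sum.\<close>
  also have "\<dots> = (\<Sum>d=1..X. M d * (\<Sum>e=1..X. \<Sum>l=1..X. mangoldt e * F (d * (e * l))))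
      - (\<Sum>d=1..X. M d * (\<Sum>e=1..X. \<Sum>l=1..X. A e * F (d * (e * l))))"
    unfolding AA by (simp add: sum_subtractf sum.distrib distrib_right distrib_left)
  also have "(\<Sum>d=1..X. M d * (\<Sum>e=1..X. \<Sum>l=1..X. mangoldt e * F (d * (e * l))))
      = (\<Sum>d=1..X. M d * (\<Sum>k=1..X. of_real (ln (real k)) * F (d * k)))"
  proof (rule sum.cong[OF refl], rule arg_cong2[where f = "(*)", OF refl])
    fix d assume "d \<in> {1..X}"
    then have "(\<Sum>e=1..X. \<Sum>l=1..X. mangoldt e * F (d * (e * l)))
        = (\<Sum>k=1..X. (\<Sum>e | e dvd k. mangoldt e) * F (d * k))"
      using Fm by (intro sum_mult_regroup[where f = "\<lambda>k. F (d * k)"]) auto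
    also have "\<dots> = (\<Sum>k=1..X. of_real (ln (real k)) * F (d * k))"
      by (intro sum.cong) (auto simp: mangoldt_sum)
    finally show "(\<Sum>e=1..X. \<Sum>l=1..X. mangoldt e * F (d * (e * l)))
        = (\<Sum>k=1..X. of_real (ln (real k)) * F (d * k))" .
  qed
  also have "(\<Sum>d=1..X. M d * (\<Sum>e=1..X. \<Sum>l=1..X. A e * F (d * (e * l))))
      = (\<Sum>d=1..X. \<Sum>e=1..X. (M d * A e) * (\<Sum>l=1..X. F (d * e * l)))"
    by (simp add: sum_distrib_left mult_ac)
  also have "\<dots> = (\<Sum>k=1..X. (\<Sum>d | d dvd k. M d * A (k div d)) * (\<Sum>l=1..X. F (k * l)))"
  proof (rule sum_mult_regroup)
    fix k assume "X < k"
    then have "F (k * l) = 0" if "l \<in> {1..X}" for l using Fm[of k l] that by (simp add: mult.commute)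
    then show "(\<Sum>l=1..X. F (k * l)) = 0" by simp
  qed
  finally have "(\<Sum>e=1..X. A' e * F e) = (\<Sum>d=1..X. M d * (\<Sum>k=1..X. of_real (ln (real k)) * F (d * k)))
      - (\<Sum>k=1..X. (\<Sum>d | d dvd k. M d * A (k div d)) * (\<Sum>l=1..X. F (k * l)))
      + (\<Sum>e=1..X. A' e * (\<Sum>k=1..X. h k * F (e * k)))" .
  moreover have "(\<Sum>n=1..X. mangoldt n * F n) = (\<Sum>n=1..X. A n * F n) + (\<Sum>n=1..X. A' n * F n)"
    unfolding AA by (simp add: distrib_right sum.distrib)
  ultimately show ?thesis by simp
qed

section \<open>Exponential sums over primes\<close>

text \<open>Expanding the square and summing over \<open>e\<close> first leaves a quadratic form in
  \<open>h\<close> whose matrix consists of geometric sums of frequency (k - l) \<beta>. Schur's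
  test bounds it by the largest row sum, and \<open>shifted_sum_bound\<close> treats each
  row.\<close>

lemma bilinear_sum_bound:
  fixes \<beta> :: real and a :: int and q X M :: nat and h :: "nat \<Rightarrow> real"
  assumes q: "q > 0" and cop: "coprime a (int q)"
    and approx: "\<bar>\<beta> - of_int a / real q\<bar> \<le> 1 / (real q)\<^sup>2" and M: "0 < M"
  defines "F \<equiv> \<lambda>n. if n \<le> X then additive_char (real n * \<beta>) else 0"
  shows "(\<Sum>e\<in>{M..<2 * M}. (norm (\<Sum>k=1..X. of_real (h k) * F (e * k)))\<^sup>2)
    \<le> (\<Sum>k=1..X div M. (h k)\<^sup>2)
       * ((real X / (real M * real q) + 1) * (5 * real M + 4 * real q * (1 + ln (real q))))"
proof -
  define Y where "Y = X div M"
  define G where "G k l = (\<Sum>e\<in>{M..<2 * M}. F (e * k) * cnj (F (e * l)))" for k l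
  let ?R = "(real X / (real M * real q) + 1) * (5 * real M + 4 * real q * (1 + ln (real q)))"
  have inner: "(\<Sum>k=1..X. of_real (h k) * F (e * k)) = (\<Sum>k=1..Y. of_real (h k) * F (e * k))"
    if "e \<in> {M..<2 * M}" for e
  proof (rule sum.mono_neutral_right)
    show "{1..Y} \<subseteq> {1..X}" using order.trans[OF _ div_le_dividend[of X M]] by (auto simp: Y_def)
    show "\<forall>k\<in>{1..X} - {1..Y}. of_real (h k) * F (e * k) = 0"
    proof
      fix k assume k: "k \<in> {1..X} - {1..Y}"
      then have "X < k * M" using M by (auto simp: Y_def less_eq_div_iff_mult_less_eq)
      also have "\<dots> \<le> k * e" using that by (intro mult_left_mono) auto
      finally show "of_real (h k) * F (e * k) = 0" by (simp add: F_def mult.commute)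
    qed
  qed auto
  have G_le: "norm (G k l) \<le> real M" for k l
  proof -
    have "norm (G k l) \<le> (\<Sum>e\<in>{M..<2 * M}. 1)"
      unfolding G_def by (rule sum_norm_le) (auto simp: F_def norm_mult)
    then show ?thesis by simp
  qed
  have G_dist: "norm (G k l) * int_dist (of_int (int l - int k) * \<beta>) \<le> 1"
    if "k \<in> {1..Y}" "l \<in> {1..Y}" for k l
  proof -
    define m where "m = max k l"
    define x where "x = of_int (int k - int l) * \<beta>"
    have m: "0 < m" using that by (auto simp: m_def)
    \<comment> \<open>The cut-off in \<open>F\<close> only moves the upper end of the range of
      \<open>e\<close>, so the correlation remains a geometric sum over an interval.\<close>
    have "G k l = (\<Sum>e\<in>{M..<min (2 * M) (Suc (X div m))}. additive_char (real e * x))"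
      unfolding G_def
    proof (rule sum.mono_neutral_cong_right)
      have iff: "e * k \<le> X \<and> e * l \<le> X \<longleftrightarrow> e \<le> X div m" for e
      proof -
        have "e * k \<le> e * m" "e * l \<le> e * m" "m = k \<or> m = l" by (auto simp: m_def)
        then show ?thesis unfolding less_eq_div_iff_mult_less_eq[OF m] by (metis order.trans)
      qed
      show "\<forall>e\<in>{M..<2 * M} - {M..<min (2 * M) (Suc (X div m))}. F (e * k) * cnj (F (e * l)) = 0"
      proof
        fix e assume "e \<in> {M..<2 * M} - {M..<min (2 * M) (Suc (X div m))}"
        then have "\<not> e \<le> X div m" by auto
        then show "F (e * k) * cnj (F (e * l)) = 0" using iff[of e] by (auto simp: F_def)
      qed
      fix e assume "e \<in> {M..<min (2 * M) (Suc (X div m))}"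
      then have "e \<le> X div m" by auto
      then have "F (e * k) * cnj (F (e * l))
          = additive_char (real (e * k) * \<beta>) * additive_char (- (real (e * l) * \<beta>))"
        using iff[of e] by (simp add: F_def cnj_additive_char)
      also have "\<dots> = additive_char (real e * x)"
        by (simp add: x_def algebra_simps flip: additive_char_add)
      finally show "F (e * k) * cnj (F (e * l)) = additive_char (real e * x)" .
    qed auto
    then have "norm (G k l) * int_dist x \<le> 1" using norm_geometric_sum_le by simp
    moreover have "of_int (int l - int k) * \<beta> = - x" by (simp add: x_def algebra_simps)
    ultimately show ?thesis by (simp add: int_dist_minus)
  qed
  have G_sym: "norm (G k l) = norm (G l k)" for k l
  proof -
    have "cnj (G k l) = G l k" by (simp add: G_def mult.commute)
    then show ?thesis by (metis complex_mod_cnj)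
  qed
  have row: "(\<Sum>l=1..Y. norm (G k l)) \<le> ?R" if "k \<in> {1..Y}" for k
  proof -
    have "(\<Sum>l=1..Y. norm (G k l)) \<le> (real Y / real q + 1) * (5 * real M + 4 * real q * (1 + ln (real q)))"
      using G_le G_dist that by (intro shifted_sum_bound[OF q cop approx, where s = "int k"]) auto
    also have "\<dots> \<le> ?R"
    proof (intro mult_right_mono add_right_mono)
      have "real Y / real q \<le> real X / real M / real q"
        unfolding Y_def by (intro divide_right_mono of_nat_div_le_of_nat) auto
      then show "real Y / real q \<le> real X / (real M * real q)" by simp
      show "0 \<le> 5 * real M + 4 * real q * (1 + ln (real q))"
        using q by (intro add_nonneg_nonneg mult_nonneg_nonneg ln_ge_zero) auto
    qed
    finally show ?thesis .
  qed
  have "complex_of_real (\<Sum>e\<in>{M..<2 * M}. (norm (\<Sum>k=1..X. of_real (h k) * F (e * k)))\<^sup>2)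
      = (\<Sum>e\<in>{M..<2 * M}. \<Sum>k=1..Y. \<Sum>l=1..Y. of_real (h k) * F (e * k) * cnj (of_real (h l) * F (e * l)))"
    unfolding of_real_sum complex_norm_square
    by (rule sum.cong[OF refl]) (simp only: inner sum_product cnj_sum)
  also have "\<dots> = (\<Sum>k=1..Y. \<Sum>l=1..Y. \<Sum>e\<in>{M..<2 * M}. of_real (h k) * F (e * k) * cnj (of_real (h l) * F (e * l)))"
    by (subst sum.swap, rule sum.cong[OF refl], rule sum.swap)
  also have "\<dots> = (\<Sum>k=1..Y. \<Sum>l=1..Y. of_real (h k * h l) * G k l)"
    by (simp add: G_def sum_distrib_left mult_ac)
  finally have eq: "complex_of_real (\<Sum>e\<in>{M..<2 * M}. (norm (\<Sum>k=1..X. of_real (h k) * F (e * k)))\<^sup>2)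
      = (\<Sum>k=1..Y. \<Sum>l=1..Y. of_real (h k * h l) * G k l)" .
  have "(\<Sum>e\<in>{M..<2 * M}. (norm (\<Sum>k=1..X. of_real (h k) * F (e * k)))\<^sup>2)
      = norm (complex_of_real (\<Sum>e\<in>{M..<2 * M}. (norm (\<Sum>k=1..X. of_real (h k) * F (e * k)))\<^sup>2))"
    unfolding norm_of_real by (rule abs_of_nonneg[symmetric]) (intro sum_nonneg, simp)
  \<comment> \<open>Schur's test: the arithmetic-geometric inequality separates \<open>h k\<close>
    from \<open>h l\<close>, and by \<open>G_sym\<close> the two halves agree.\<close>
  also have "\<dots> \<le> (\<Sum>k=1..Y. \<Sum>l=1..Y. ((h k)\<^sup>2 + (h l)\<^sup>2) / 2 * norm (G k l))"
    unfolding eq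
  proof (intro sum_norm_le)
    fix k l
    have "\<bar>h k * h l\<bar> \<le> ((h k)\<^sup>2 + (h l)\<^sup>2) / 2"
      using sum_squares_bound[of "\<bar>h k\<bar>" "\<bar>h l\<bar>"] by (simp add: abs_mult)
    then show "norm (of_real (h k * h l) * G k l) \<le> ((h k)\<^sup>2 + (h l)\<^sup>2) / 2 * norm (G k l)"
      unfolding norm_mult norm_of_real by (intro mult_right_mono) auto
  qed
  also have "\<dots> = (\<Sum>k=1..Y. \<Sum>l=1..Y. (h k)\<^sup>2 / 2 * norm (G k l))
      + (\<Sum>k=1..Y. \<Sum>l=1..Y. (h l)\<^sup>2 / 2 * norm (G k l))"
    by (simp add: sum.distrib[symmetric] add_divide_distrib distrib_right)
  also have "(\<Sum>k=1..Y. \<Sum>l=1..Y. (h l)\<^sup>2 / 2 * norm (G k l)) = (\<Sum>k=1..Y. \<Sum>l=1..Y. (h k)\<^sup>2 / 2 * norm (G k l))"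
    by (subst sum.swap) (simp add: G_sym)
  also have "(\<Sum>k=1..Y. \<Sum>l=1..Y. (h k)\<^sup>2 / 2 * norm (G k l)) + (\<Sum>k=1..Y. \<Sum>l=1..Y. (h k)\<^sup>2 / 2 * norm (G k l))
      = (\<Sum>k=1..Y. (h k)\<^sup>2 * (\<Sum>l=1..Y. norm (G k l)))"
    by (simp add: sum.distrib[symmetric] sum_distrib_left mult.commute)
  also have "\<dots> \<le> (\<Sum>k=1..Y. (h k)\<^sup>2 * ?R)"
    using row by (intro sum_mono mult_left_mono) auto
  also have "\<dots> = (\<Sum>k=1..Y. (h k)\<^sup>2) * ?R" by (simp add: sum_distrib_right)
  finally show ?thesis unfolding Y_def .
qed

lemma sum_dyadic_blocks:
  fixes f :: "nat \<Rightarrow> 'a :: comm_monoid_add"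
  shows "(\<Sum>e\<in>{1..<2 ^ I}. f e) = (\<Sum>i<I. \<Sum>e\<in>{2 ^ i..<2 * 2 ^ i}. f e)"
proof (induction I)
  case (Suc I)
  have "(\<Sum>e\<in>{1..<2 ^ Suc I}. f e) = (\<Sum>e\<in>{1..<2 ^ I}. f e) + (\<Sum>e\<in>{2 ^ I..<2 * 2 ^ I}. f e)"
    by (subst sum.atLeastLessThan_concat) auto
  then show ?case using Suc.IH by simp
qed simp

text \<open>
  Only blocks with \<open>U / 2 < M \<le> X / U\<close> contribute, since \<open>w\<close> and \<open>h\<close> both vanish up to \<open>U\<close>.
\<close>

lemma type_II_dyadic_bound:
  fixes \<beta> L :: real and a :: int and q X M U :: nat and w h :: "nat \<Rightarrow> real"
  assumes q: "q > 0" and cop: "coprime a (int q)"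
    and approx: "\<bar>\<beta> - of_int a / real q\<bar> \<le> 1 / (real q)\<^sup>2" and M: "0 < M"
    and L: "1 \<le> L" "ln (real q) \<le> L" "ln (2 * real X) \<le> L" and X: "1 \<le> X" and U: "1 \<le> U"
    and w: "\<And>e. e \<le> U \<Longrightarrow> w e = 0" "\<And>e. 1 \<le> e \<Longrightarrow> \<bar>w e\<bar> \<le> ln (real e)"
    and h: "\<And>k. 1 \<le> k \<Longrightarrow> k \<le> U \<Longrightarrow> h k = 0" "\<And>k. 1 \<le> k \<Longrightarrow> \<bar>h k\<bar> \<le> real (card {d. d dvd k})"
  defines "F \<equiv> \<lambda>n. if n \<le> X then additive_char (real n * \<beta>) else 0"
  shows "(\<Sum>e\<in>{M..<2 * M}. \<bar>w e\<bar> * norm (\<Sum>k=1..X. of_real (h k) * F (e * k)))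
    \<le> 8 * L ^ 3 * sqrt (real X * (real X / real q + 3 * real X / real U + real q))"
    (is "(\<Sum>e\<in>_. \<bar>w e\<bar> * norm (?T e)) \<le> ?B")
proof -
  have B0: "0 \<le> ?B" using L by (intro mult_nonneg_nonneg) auto
  consider "2 * M \<le> U" | "X < M * (U + 1)" | "U < 2 * M" "M * (U + 1) \<le> X" by linarith
  then show ?thesis
  proof cases
    case 1
    then have "(\<Sum>e\<in>{M..<2 * M}. \<bar>w e\<bar> * norm (?T e)) = 0"
      using w(1) by (intro sum.neutral) auto
    then show ?thesis using B0 by simp
  next
    case 2
    have "?T e = 0" if "e \<in> {M..<2 * M}" for e
    proof (rule sum.neutral, rule ballI)
      fix k assume k: "k \<in> {1..X}"
      show "of_real (h k) * F (e * k) = 0"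
      proof (cases "k \<le> U")
        case False
        have "X < M * (U + 1)" by (rule 2)
        also have "\<dots> \<le> e * k" using that False by (intro mult_mono) auto
        finally show ?thesis by (simp add: F_def)
      qed (use h k in simp)
    qed
    then have "(\<Sum>e\<in>{M..<2 * M}. \<bar>w e\<bar> * norm (?T e)) = 0" by (intro sum.neutral) auto
    then show ?thesis using B0 by simp
  next
    case 3
    define Y where "Y = X div M"
    have "M * 1 \<le> M * (U + 1)" by (intro mult_left_mono) auto
    then have MX: "M \<le> X" using 3 by linarith
    have Y1: "1 \<le> Y" using MX M by (simp add: Y_def less_eq_div_iff_mult_less_eq)
    have YX: "real Y \<le> real X / real M" unfolding Y_def by (rule of_nat_div_le_of_nat)
    have lnX: "0 \<le> ln (real X)" "ln (real X) \<le> ln (2 * real X)" using X by auto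
    have w2: "(\<Sum>e\<in>{M..<2 * M}. \<bar>w e\<bar>\<^sup>2) \<le> real M * L\<^sup>2"
    proof -
      have "(\<Sum>e\<in>{M..<2 * M}. \<bar>w e\<bar>\<^sup>2) \<le> (\<Sum>e\<in>{M..<2 * M}. L\<^sup>2)"
      proof (intro sum_mono power_mono)
        fix e assume e: "e \<in> {M..<2 * M}"
        have "\<bar>w e\<bar> \<le> ln (real e)" using e M by (intro w) auto
        also have "\<dots> \<le> ln (2 * real X)" using e M MX X by (subst ln_le_cancel_iff) auto
        finally show "\<bar>w e\<bar> \<le> L" using L by simp
      qed auto
      then show ?thesis by simp
    qed
    have h2: "(\<Sum>k=1..Y. (h k)\<^sup>2) \<le> 8 * L ^ 3 * (real X / real M)"
    proof -
      have "(\<Sum>k=1..Y. (h k)\<^sup>2) \<le> (\<Sum>k=1..Y. (real (card {d. d dvd k}))\<^sup>2)"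
      proof (rule sum_mono)
        fix k assume "k \<in> {1..Y}"
        then have "\<bar>h k\<bar> \<le> real (card {d. d dvd k})" by (intro h) auto
        then show "(h k)\<^sup>2 \<le> (real (card {d. d dvd k}))\<^sup>2" by (metis abs_ge_zero power2_abs power_mono)
      qed
      also have "\<dots> \<le> real Y * (1 + ln (real Y)) ^ 3" by (rule sum_divisor_count_squared_le[OF Y1])
      also have "\<dots> \<le> real X / real M * (2 * L) ^ 3"
      proof (intro mult_mono power_mono YX)
        have "real Y \<le> real X" unfolding Y_def by simp
        then have "ln (real Y) \<le> ln (real X)" using Y1 by (subst ln_le_cancel_iff) auto
        then show "1 + ln (real Y) \<le> 2 * L" using lnX L by linarith
        show "0 \<le> 1 + ln (real Y)" using Y1 by (intro add_nonneg_nonneg ln_ge_zero) auto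
        then show "0 \<le> (1 + ln (real Y)) ^ 3" by simp
      qed auto
      finally show ?thesis by (simp add: power_mult_distrib mult_ac)
    qed
    have R: "(real X / (real M * real q) + 1) * (5 * real M + 4 * real q * (1 + ln (real q)))
        \<le> 8 * L * (real X / real q + 3 * real X / real U + real q)"
    proof -
      have "5 * real M + 4 * real q * (1 + ln (real q)) \<le> 8 * L * real M + 4 * real q * (L + L)"
      proof (intro add_mono mult_left_mono)
        have "5 * 1 * real M \<le> 8 * L * real M" using L by (intro mult_right_mono) auto
        then show "5 * real M \<le> 8 * L * real M" by simp
      qed (use L in auto)
      also have "\<dots> = 8 * L * (real M + real q)" by (simp add: algebra_simps)
      finally have "(real X / (real M * real q) + 1) * (5 * real M + 4 * real q * (1 + ln (real q)))
          \<le> (real X / (real M * real q) + 1) * (8 * L * (real M + real q))"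
        by (intro mult_left_mono) auto
      also have "\<dots> = 8 * L * (real X / real q + real X / real M + real M + real q)"
        using q M by (simp add: field_simps)
      also have "\<dots> \<le> 8 * L * (real X / real q + 3 * real X / real U + real q)"
      proof (intro mult_left_mono)
        \<comment> \<open>The two ends of the surviving range give X/M \<le> 2 X/U and M \<le> X/U,
          together 3 X/U.\<close>
        define t where "t = real X / real U"
        have "real X / real M \<le> real X / (real U / 2)"
          using 3 U M by (intro divide_left_mono) auto
        also have "\<dots> = 2 * t" by (simp add: t_def)
        finally have "real X / real M \<le> 2 * t" .
        moreover have "real M \<le> t"
        proof -
          have "M * U \<le> X" using 3 by simp
          then have "real M * real U \<le> real X" by (metis of_nat_le_iff of_nat_mult)
          then show ?thesis using U by (simp add: t_def field_simps)
        qed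
        moreover have "3 * real X / real U = 3 * t" by (simp add: t_def)
        ultimately show "real X / real q + real X / real M + real M + real q
            \<le> real X / real q + 3 * real X / real U + real q" by linarith
      qed (use L in auto)
      finally show ?thesis .
    qed
    \<comment> \<open>Under the square there are L^2 from \<open>w\<close>, L^3 from the divisor
      count and \<open>L\<close> from the geometric sums, so L^3 remains after the root. The block
      length \<open>M\<close> cancels.\<close>
    have "(\<Sum>e\<in>{M..<2 * M}. \<bar>w e\<bar> * norm (?T e))\<^sup>2
        \<le> (\<Sum>e\<in>{M..<2 * M}. \<bar>w e\<bar>\<^sup>2) * (\<Sum>e\<in>{M..<2 * M}. (norm (?T e))\<^sup>2)"
      by (rule Cauchy_Schwarz_ineq_sum)
    also have "\<dots> \<le> (real M * L\<^sup>2) * ((8 * L ^ 3 * (real X / real M))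
        * (8 * L * (real X / real q + 3 * real X / real U + real q)))"
    proof (intro mult_mono w2)
      have "(\<Sum>e\<in>{M..<2 * M}. (norm (?T e))\<^sup>2) \<le> (\<Sum>k=1..Y. (h k)\<^sup>2)
          * ((real X / (real M * real q) + 1) * (5 * real M + 4 * real q * (1 + ln (real q))))"
        unfolding F_def Y_def by (rule bilinear_sum_bound[OF q cop approx M])
      also have "\<dots> \<le> (8 * L ^ 3 * (real X / real M))
          * (8 * L * (real X / real q + 3 * real X / real U + real q))"
      proof (rule mult_mono[OF h2 R])
        show "0 \<le> (real X / (real M * real q) + 1) * (5 * real M + 4 * real q * (1 + ln (real q)))"
          using q by (intro mult_nonneg_nonneg add_nonneg_nonneg ln_ge_zero) auto
      qed (use L in auto)
      finally show "(\<Sum>e\<in>{M..<2 * M}. (norm (?T e))\<^sup>2) \<le> (8 * L ^ 3 * (real X / real M))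
          * (8 * L * (real X / real q + 3 * real X / real U + real q))" .
    qed (use L in \<open>auto intro: sum_nonneg\<close>)
    also have "\<dots> = (8 * L ^ 3)\<^sup>2 * (real X * (real X / real q + 3 * real X / real U + real q))"
    proof -
      have *: "(m * L\<^sup>2) * ((8 * L ^ 3 * (x / m)) * (8 * L * z)) = (8 * L ^ 3)\<^sup>2 * (x * z)"
        if "m \<noteq> 0" for m x z :: real
        using that by (simp add: power_mult_distrib power2_eq_square eval_nat_numeral)
      show ?thesis by (rule *) (use M in simp)
    qed
    also have "\<dots> = ?B\<^sup>2" by (simp add: power_mult_distrib)
    finally show ?thesis using B0 by (rule power2_le_imp_le)
  qed
qed

text \<open>The terms of the bound are the pieces of Vaughan's identity with both cut-offs equal to
  \<open>U\<close>: the short sum, the logarithmic type I sum of level \<open>U\<close>, the plain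
  one of level \<open>U * U\<close>, and the type II sum, where L^3 per dyadic block times at most 3
  L blocks gives L^4.\<close>

lemma exp_sum_mangoldt_bound:
  fixes \<beta> L :: real and a :: int and q X U :: nat
  assumes q: "q > 0" and cop: "coprime a (int q)"
    and approx: "\<bar>\<beta> - of_int a / real q\<bar> \<le> 1 / (real q)\<^sup>2"
    and L: "1 \<le> L" "ln (real q) \<le> L" "ln (2 * real X) \<le> L" and U: "1 \<le> U" "U * U \<le> X"
  shows "norm (\<Sum>n=1..X. mangoldt n * additive_char (real n * \<beta>))
    \<le> real U * L
      + 40 * L\<^sup>2 * (real X / real q + real U + real q)
      + 20 * L\<^sup>2 * (real X / real q + (real U)\<^sup>2 + real q)
      + 24 * L ^ 4 * sqrt (real X * (real X / real q + 3 * real X / real U + real q))"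
proof -
  define F where "F = (\<lambda>n. if n \<le> X then additive_char (real n * \<beta>) else 0)"
  define \<mu> where "\<mu> = (\<lambda>d. if d \<le> U then moebius d else 0)"
  define \<Lambda> where "\<Lambda> = (\<lambda>e. if e \<le> U then mangoldt e else 0 :: real)"
  define w where "w = (\<lambda>e. if U < e then mangoldt e else 0 :: real)"
  define h where "h = (\<lambda>k. \<Sum>d | d dvd k. if U < d then moebius d else 0)"
  define c where "c k = (\<Sum>d | d dvd k. complex_of_real (\<mu> d) * of_real (\<Lambda> (k div d)))" for k
  define W where "W = sqrt (real X * (real X / real q + 3 * real X / real U + real q))"
  have "U * 1 \<le> U * U" using U by (intro mult_left_mono) auto
  then have UX: "U \<le> X" using U by linarith
  then have X: "1 \<le> X" using U by linarith
  have ln_le: "ln (real n) \<le> L" if "1 \<le> n" "n \<le> X" for n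
  proof -
    have "ln (real n) \<le> ln (2 * real X)" using that by (subst ln_le_cancel_iff) auto
    then show ?thesis using L by simp
  qed
  have F_norm: "norm (F n) \<le> 1" for n by (simp add: F_def)
  have F_sum: "(\<Sum>k=1..X. v k * F (d * k)) = (\<Sum>k\<in>{1..<Suc (X div d)}. v k * additive_char (real k * (real d * \<beta>)))"
    if "1 \<le> d" for d and v :: "nat \<Rightarrow> complex"
  proof (rule sum.mono_neutral_cong_right)
    have iff: "d * k \<le> X \<longleftrightarrow> k \<le> X div d" for k
      using that by (simp add: less_eq_div_iff_mult_less_eq mult.commute)
    show "{1..<Suc (X div d)} \<subseteq> {1..X}" using order.trans[OF _ div_le_dividend[of X d]] by auto
    show "\<forall>k\<in>{1..X} - {1..<Suc (X div d)}. v k * F (d * k) = 0"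
      using iff by (auto simp: F_def less_Suc_eq_le)
    show "v k * F (d * k) = v k * additive_char (real k * (real d * \<beta>))" if "k \<in> {1..<Suc (X div d)}" for k
      using that iff[of k] by (auto simp: F_def mult_ac)
  qed auto
  have div_le: "real (X div d) * real d \<le> real X" for d
    by (metis div_times_less_eq_dividend of_nat_le_iff of_nat_mult)

  have S0: "norm (\<Sum>n=1..X. of_real (\<Lambda> n) * F n) \<le> real U * L"
  proof -
    have "(\<Sum>n=1..X. of_real (\<Lambda> n) * F n) = (\<Sum>n=1..U. of_real (\<Lambda> n) * F n)"
      using UX by (intro sum.mono_neutral_right) (auto simp: \<Lambda>_def)
    also have "norm \<dots> \<le> (\<Sum>n=1..U. L)"
    proof (rule sum_norm_le)
      fix n assume n: "n \<in> {1..U}"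
      then have "\<bar>\<Lambda> n\<bar> \<le> L"
        using mangoldt_le[of n] ln_le[of n] UX by (auto simp: \<Lambda>_def)
      then have "norm (of_real (\<Lambda> n) * F n) \<le> L * 1"
        unfolding norm_mult norm_of_real using F_norm L by (intro mult_mono) auto
      then show "norm (of_real (\<Lambda> n) * F n) \<le> L" by simp
    qed
    finally show ?thesis by simp
  qed

  have S1: "norm (\<Sum>d=1..X. of_real (\<mu> d) * (\<Sum>k=1..X. of_real (ln (real k)) * F (d * k)))
      \<le> 40 * L\<^sup>2 * (real X / real q + real U + real q)"
  proof -
    define T where "T d = (\<Sum>k=1..X. of_real (ln (real k)) * F (d * k))" for d
    have "(\<Sum>d=1..X. of_real (\<mu> d) * T d) = (\<Sum>d=1..U. of_real (\<mu> d) * T d)"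
      using UX by (intro sum.mono_neutral_right) (auto simp: \<mu>_def)
    \<comment> \<open>Division by 2 L fits \<open>T d\<close> to \<open>type_I_sum_bound\<close>:
      with logarithmic weights it is at most L X/d trivially, and at most 2 L over the distance by
      partial summation.\<close>
    also have "norm \<dots> \<le> (\<Sum>d=1..U. 2 * L * (norm (T d) / (2 * L)))"
    proof (rule sum_norm_le)
      fix d
      have "\<bar>\<mu> d\<bar> \<le> 1" by (simp add: \<mu>_def abs_moebius_le)
      then have "norm (of_real (\<mu> d) * T d) \<le> 1 * norm (T d)"
        unfolding norm_mult norm_of_real by (intro mult_right_mono) auto
      then show "norm (of_real (\<mu> d) * T d) \<le> 2 * L * (norm (T d) / (2 * L))" using L by simp
    qed
    also have "\<dots> = 2 * L * (\<Sum>d=1..U. norm (T d) / (2 * L))" by (simp add: sum_distrib_left)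
    also have "\<dots> \<le> 2 * L * (20 * L * (real X / real q + real U + real q))"
    proof (intro mult_left_mono type_I_sum_bound[OF q cop approx _ L(1,2)])
      have "ln (real U + 1) \<le> ln (2 * real X)" using UX X by (subst ln_le_cancel_iff) auto
      then show "ln (real U + 1) \<le> L" using L by simp
    next
      fix d assume d: "1 \<le> d" "d \<le> U"
      define K where "K = X div d"
      have K1: "1 \<le> K" using d UX by (simp add: K_def less_eq_div_iff_mult_less_eq)
      have KX: "K \<le> X" by (simp add: K_def)
      have T_eq: "T d = (\<Sum>k\<in>{1..<Suc K}. of_real (ln (real k)) * additive_char (real k * (real d * \<beta>)))"
        unfolding T_def K_def using d by (intro F_sum)
      have "norm (T d) \<le> (\<Sum>k\<in>{1..<Suc K}. L)"
        unfolding T_eq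
      proof (rule sum_norm_le)
        fix k assume "k \<in> {1..<Suc K}"
        then have "0 \<le> ln (real k)" "ln (real k) \<le> L" using KX by (auto intro!: ln_le)
        then show "norm (of_real (ln (real k)) * additive_char (real k * (real d * \<beta>))) \<le> L"
          by (simp add: norm_mult)
      qed
      then have "norm (T d) \<le> real K * L" by simp
      then have "norm (T d) / (2 * L) \<le> real K * L / (2 * L)" using L by (intro divide_right_mono) auto
      also have "\<dots> = real K / 2" using L by simp
      also have "\<dots> \<le> real K" by simp
      finally have "norm (T d) / (2 * L) * real d \<le> real K * real d" by (intro mult_right_mono) auto
      also have "\<dots> \<le> real X" unfolding K_def by (rule div_le)
      finally show "norm (T d) / (2 * L) * real d \<le> real X" .
      show "norm (T d) / (2 * L) * int_dist (real d * \<beta>) \<le> 1"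
      \<comment> \<open>Partial summation needs the reciprocal of the distance; at distance 0 the
        product vanishes.\<close>
      proof (cases "int_dist (real d * \<beta>) = 0")
        case False
        then have pos: "0 < int_dist (real d * \<beta>)" using int_dist_nonneg[of "real d * \<beta>"] by simp
        have "norm (T d) \<le> 2 * ln (real K) * (1 / int_dist (real d * \<beta>))"
          unfolding T_eq
        proof (rule abel_summation_bound)
          show "norm (\<Sum>k\<in>{1..<Suc n}. additive_char (real k * (real d * \<beta>))) \<le> 1 / int_dist (real d * \<beta>)" for n
            using norm_geometric_sum_le[of "real d * \<beta>" 1 "Suc n"] pos by (simp add: field_simps)
        qed (use K1 in auto)
        also have "\<dots> \<le> 2 * L * (1 / int_dist (real d * \<beta>))"
          using ln_le[OF K1 KX] pos by (intro mult_right_mono mult_left_mono) auto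
        finally show ?thesis using pos L by (simp add: field_simps)
      qed simp
    qed (use L in auto)
    also have "\<dots> = 40 * L\<^sup>2 * (real X / real q + real U + real q)" by (simp add: power2_eq_square)
    finally show ?thesis by (simp add: T_def)
  qed

  have S2: "norm (\<Sum>k=1..X. c k * (\<Sum>l=1..X. F (k * l)))
      \<le> 20 * L\<^sup>2 * (real X / real q + (real U)\<^sup>2 + real q)"
  proof -
    define T where "T k = (\<Sum>l=1..X. F (k * l))" for k
    \<comment> \<open>Two functions supported up to \<open>U\<close> convolve to one supported up to
      \<open>U * U\<close>; \<open>U * U \<le> X\<close> keeps this within the range where
      \<open>c_le\<close> holds.\<close>
    have c0: "c k = 0" if "U * U < k" for k
      unfolding c_def
    proof (rule sum.neutral, rule ballI)
      fix d assume "d \<in> {d. d dvd k}"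
      then have "k = d * (k div d)" by simp
      then have "\<not> (d \<le> U \<and> k div d \<le> U)"
        using that mult_le_mono[of d U "k div d" U] by linarith
      then show "complex_of_real (\<mu> d) * of_real (\<Lambda> (k div d)) = 0" by (auto simp: \<mu>_def \<Lambda>_def)
    qed
    have c_le: "norm (c k) \<le> L" if k: "1 \<le> k" "k \<le> X" for k
    proof -
      have "norm (c k) \<le> (\<Sum>d | d dvd k. mangoldt (k div d))"
        unfolding c_def
      proof (rule sum_norm_le)
        fix d
        have "\<bar>\<mu> d\<bar> \<le> 1" by (simp add: \<mu>_def abs_moebius_le)
        moreover have "\<bar>\<Lambda> (k div d)\<bar> \<le> mangoldt (k div d)" by (simp add: \<Lambda>_def mangoldt_nonneg)
        ultimately have "\<bar>\<mu> d\<bar> * \<bar>\<Lambda> (k div d)\<bar> \<le> 1 * mangoldt (k div d)" by (intro mult_mono) auto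
        then show "norm (complex_of_real (\<mu> d) * of_real (\<Lambda> (k div d))) \<le> mangoldt (k div d)"
          by (simp add: norm_mult)
      qed
      also have "\<dots> = (\<Sum>d | d dvd k. mangoldt d)"
        using k by (intro sum.reindex_bij_witness[of _ "\<lambda>d. k div d" "\<lambda>d. k div d"]) (auto elim!: dvdE)
      also have "\<dots> = ln (real k)" using k by (simp add: mangoldt_sum)
      finally show ?thesis using ln_le[OF k] by simp
    qed
    have "(\<Sum>k=1..X. c k * T k) = (\<Sum>k=1..U * U. c k * T k)"
      using U by (intro sum.mono_neutral_right) (auto simp: c0)
    also have "norm \<dots> \<le> (\<Sum>k=1..U * U. L * norm (T k))"
    proof (rule sum_norm_le)
      fix k assume "k \<in> {1..U * U}"
      then show "norm (c k * T k) \<le> L * norm (T k)"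
        unfolding norm_mult using U by (intro mult_right_mono c_le) auto
    qed
    also have "\<dots> = L * (\<Sum>k=1..U * U. norm (T k))" by (simp add: sum_distrib_left)
    also have "\<dots> \<le> L * (20 * L * (real X / real q + real (U * U) + real q))"
    proof (intro mult_left_mono type_I_sum_bound[OF q cop approx _ L(1,2)])
      have "real (U * U) \<le> real X" using U by (intro of_nat_mono)
      then have "ln (real (U * U) + 1) \<le> ln (2 * real X)"
        using X by (subst ln_le_cancel_iff) (auto intro: add_nonneg_pos)
      then show "ln (real (U * U) + 1) \<le> L" using L by simp
    next
      fix k assume k: "1 \<le> k" "k \<le> U * U"
      have T_eq: "T k = (\<Sum>l\<in>{1..<Suc (X div k)}. additive_char (real l * (real k * \<beta>)))"
        unfolding T_def using F_sum[of k "\<lambda>_. 1"] k by simp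
      have "norm (T k) \<le> (\<Sum>l\<in>{1..<Suc (X div k)}. 1)" unfolding T_eq by (rule sum_norm_le) simp
      then have "norm (T k) \<le> real (X div k)" by simp
      then have "norm (T k) * real k \<le> real (X div k) * real k" by (intro mult_right_mono) auto
      then show "norm (T k) * real k \<le> real X" using div_le[of k] by linarith
      show "norm (T k) * int_dist (real k * \<beta>) \<le> 1" unfolding T_eq by (rule norm_geometric_sum_le)
    qed (use L in auto)
    also have "\<dots> = 20 * L\<^sup>2 * (real X / real q + (real U)\<^sup>2 + real q)" by (simp add: power2_eq_square)
    finally show ?thesis by (simp add: T_def)
  qed

  have S3: "norm (\<Sum>e=1..X. of_real (w e) * (\<Sum>k=1..X. of_real (h k) * F (e * k))) \<le> 24 * L ^ 4 * W"
  proof -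
    define T where "T e = (\<Sum>k=1..X. of_real (h k) * F (e * k))" for e
    obtain n where n: "2 ^ n \<le> X" "X < 2 ^ (n + 1)" using ex_power_ivl1[of 2 X] X by auto
    have w_le: "\<bar>w e\<bar> \<le> ln (real e)" if "1 \<le> e" for e
      using mangoldt_le[of e] that by (simp add: w_def)
    have h0: "h k = 0" if "k \<le> U" "1 \<le> k" for k
      unfolding h_def using that by (intro sum.neutral) (auto dest!: dvd_imp_le)
    have h_le: "\<bar>h k\<bar> \<le> real (card {d. d dvd k})" for k
    proof -
      have "\<bar>h k\<bar> \<le> (\<Sum>d | d dvd k. \<bar>if U < d then moebius d else 0\<bar>)" unfolding h_def by (rule sum_abs)
      also have "\<dots> \<le> (\<Sum>d | d dvd k. 1)" by (intro sum_mono) (auto simp: abs_moebius_le)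
      finally show ?thesis by simp
    qed
    have W0: "0 \<le> W" by (simp add: W_def)
    have "norm (\<Sum>e=1..X. of_real (w e) * T e) \<le> (\<Sum>e=1..X. \<bar>w e\<bar> * norm (T e))"
      by (rule sum_norm_le) (simp add: norm_mult)
    also have "\<dots> \<le> (\<Sum>e\<in>{1..<2 ^ (n + 1)}. \<bar>w e\<bar> * norm (T e))"
      using n by (intro sum_mono2) auto
    also have "\<dots> = (\<Sum>i<n + 1. \<Sum>e\<in>{2 ^ i..<2 * 2 ^ i}. \<bar>w e\<bar> * norm (T e))"
      by (rule sum_dyadic_blocks)
    also have "\<dots> \<le> (\<Sum>i<n + 1. 8 * L ^ 3 * W)"
    proof (rule sum_mono)
      fix i
      show "(\<Sum>e\<in>{2 ^ i..<2 * 2 ^ i}. \<bar>w e\<bar> * norm (T e)) \<le> 8 * L ^ 3 * W"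
        unfolding W_def T_def F_def
        by (rule type_II_dyadic_bound[OF q cop approx _ L X U(1)]) (auto simp: w_le h0 h_le, simp add: w_def)
    qed
    also have "\<dots> = (real n + 1) * (8 * L ^ 3 * W)" by (simp add: algebra_simps)
    \<comment> \<open>There are n + 1 blocks with 2^n \<le> X, and ln 2 \<ge> 1/2 gives n \<le> 2
      L.\<close>
    also have "\<dots> \<le> (3 * L) * (8 * L ^ 3 * W)"
    proof (intro mult_right_mono)
      have "real n * ln 2 = ln (real (2 ^ n))" by (simp add: ln_realpow)
      also have "\<dots> \<le> L" using n(1) by (intro ln_le) auto
      finally have "real n * ln 2 \<le> L" .
      moreover have "real n * (1 / 2) \<le> real n * ln 2"
        using ln2_ge_two_thirds by (intro mult_left_mono) auto
      ultimately show "real n + 1 \<le> 3 * L" using L by simp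
    qed (use L W0 in auto)
    also have "\<dots> = 24 * L ^ 4 * W" by (simp add: eval_nat_numeral)
    finally show ?thesis by (simp add: T_def)
  qed

  have "(\<Sum>n=1..X. mangoldt n * additive_char (real n * \<beta>)) = (\<Sum>n=1..X. mangoldt n * F n)"
    by (intro sum.cong) (auto simp: F_def)
  also have "\<dots> = (\<Sum>n=1..X. of_real (\<Lambda> n) * F n)
      + (\<Sum>d=1..X. of_real (\<mu> d) * (\<Sum>k=1..X. of_real (ln (real k)) * F (d * k)))
      - (\<Sum>k=1..X. c k * (\<Sum>l=1..X. F (k * l)))
      + (\<Sum>e=1..X. of_real (w e) * (\<Sum>k=1..X. of_real (h k) * F (e * k)))"
    unfolding c_def \<mu>_def \<Lambda>_def w_def h_def by (rule vaughan_identity) (simp add: F_def)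
  also have "norm \<dots> \<le> real U * L
      + 40 * L\<^sup>2 * (real X / real q + real U + real q)
      + 20 * L\<^sup>2 * (real X / real q + (real U)\<^sup>2 + real q) + 24 * L ^ 4 * W"
    by (intro order.trans[OF norm_triangle_ineq] order.trans[OF norm_triangle_ineq4] add_mono S0 S1 S2 S3)
  finally show ?thesis unfolding W_def .
qed

section \<open>The minor arcs\<close>

lemma exp_sum_eq:
  assumes "0 < b"
  shows "exp_sum b N \<alpha> = (\<Sum>n=1..N div b. mangoldt n * additive_char (real n * (real b * \<alpha>)))"
proof -
  have "real n \<le> real N / real b \<longleftrightarrow> n \<le> N div b" for n
  proof -
    have "real n \<le> real N / real b \<longleftrightarrow> real (n * b) \<le> real N" using assms by (simp add: field_simps)
    also have "\<dots> \<longleftrightarrow> n \<le> N div b" using assms by (simp add: less_eq_div_iff_mult_less_eq del: of_nat_mult)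
    finally show ?thesis .
  qed
  then have "{n. 0 < n \<and> real n \<le> real N / real b} = {1..N div b}"
    by (simp add: set_eq_iff Suc_le_eq)
  then show ?thesis by (simp add: exp_sum_def mult.assoc)
qed

text \<open>The fraction near \<alpha> need be neither reduced nor in (0, 1]. Cancelling the gcd and
  shifting by an integer \<open>t\<close> repairs both: the denominator only decreases, and the
  distance modulo 1 ignores the shift.\<close>

lemma rational_near_in_major_arcs:
  fixes \<alpha> Q :: real and h :: int and k N :: nat
  assumes "\<alpha> \<in> {0..<1}" "0 < k" "real k \<le> Q" "\<bar>\<alpha> - of_int h / real k\<bar> \<le> Q / real N"
  shows "\<alpha> \<in> major_arcs Q N"
proof -
  define g where "g = gcd h (int k)"
  define a' where "a' = h div g"
  define q where "q = int k div g"
  have g: "0 < g" using assms by (simp add: g_def)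
  have ha: "h = g * a'" and kq: "int k = g * q" by (simp_all add: g_def a'_def q_def)
  have q: "0 < q" using kq g assms by (metis of_nat_0_less_iff zero_less_mult_pos)
  have cop: "coprime a' q"
    unfolding a'_def q_def g_def using assms by (intro div_gcd_coprime) auto
  \<comment> \<open>Residues are taken in 1..q instead of 0..q - 1, as \<open>major_arcs\<close>
    demands; an integer becomes 1/1.\<close>
  define t where "t = (a' - 1) div q"
  define a where "a = (a' - 1) mod q + 1"
  have a_eq: "a' = t * q + a" by (simp add: a_def t_def)
  have a_bd: "1 \<le> a" "a \<le> q" using q by (auto simp: a_def add1_zle_eq)
  have cop': "coprime a q" using cop unfolding a_eq coprime_iff_gcd_eq_1 by (simp only: gcd.commute[of _ q] gcd_add_mult)
  define an where "an = nat a"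
  define qn where "qn = nat q"
  have cn: "a = int an" "q = int qn" using a_bd q by (auto simp: an_def qn_def)
  have rk: "real k = of_int g * of_int q" using kq by (metis of_int_mult of_int_of_nat_eq)
  have frac: "of_int h / real k = real an / real qn + of_int t"
  proof -
    have "of_int h / real k = real_of_int a' / of_int q"
      unfolding rk ha using g by simp
    also have "\<dots> = of_int a / of_int q + of_int t" unfolding a_eq using q by (simp add: field_simps)
    finally show ?thesis by (simp add: cn)
  qed
  have "infdist (\<alpha> - real an / real qn) \<int> \<le> dist (\<alpha> - real an / real qn) (of_int t)"
    by (rule infdist_le) simp
  also have "\<dots> = \<bar>\<alpha> - of_int h / real k\<bar>" by (simp add: frac dist_real_def algebra_simps)
  finally have "\<alpha> \<in> major_arc Q N an qn" using assms by (simp add: major_arc_def)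
  moreover have "real qn \<le> Q"
  proof -
    have "1 * q \<le> g * q" using g q by (intro mult_right_mono) auto
    then have "qn \<le> k" using kq cn by simp
    then show ?thesis using assms by linarith
  qed
  moreover have "1 \<le> an" "an \<le> qn" "coprime an qn" using a_bd cop' by (auto simp: cn)
  ultimately show ?thesis unfolding major_arcs_def by blast
qed

text \<open>Dirichlet's error 1/(q P) is used twice: it is at most 1/q^2 because q \<le> P, and at
  most Q/N because P \<ge> N/Q. By the latter, c q \<le> Q would let a/(c q) put \<alpha> on a major
  arc.\<close>

lemma minor_arc_approximation:
  fixes \<alpha> Q :: real and N c :: nat
  assumes "\<alpha> \<in> minor_arcs Q N" "0 < c" "0 < N" "1 \<le> Q" "Q \<le> real N"
  obtains a :: int and q :: nat where "0 < q" "coprime a (int q)"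
    "\<bar>real c * \<alpha> - of_int a / real q\<bar> \<le> 1 / (real q)\<^sup>2" "Q < real c * real q" "real q \<le> 2 * real N / Q"
proof -
  define P where "P = nat \<lceil>real N / Q\<rceil>"
  have NQ: "1 \<le> real N / Q" using assms by (simp add: field_simps)
  have P: "real N / Q \<le> real P" unfolding P_def by linarith
  then have "0 < real P" using NQ by linarith
  then have P0: "0 < P" by simp
  have P2: "real P \<le> 2 * (real N / Q)" using NQ unfolding P_def by linarith
  obtain a k where ak: "coprime a k" "0 < k" "k \<le> int P" "\<bar>of_int k * (real c * \<alpha>) - of_int a\<bar> < 1 / real P"
    using Dirichlet_approx_coprime[OF P0] by blast
  define q where "q = nat k"
  have q: "k = int q" "0 < q" "q \<le> P" using ak by (auto simp: q_def)
  have dist: "\<bar>real c * \<alpha> - of_int a / real q\<bar> \<le> 1 / (real q * real P)"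
  proof -
    have "real c * \<alpha> - of_int a / real q = (real q * (real c * \<alpha>) - of_int a) / real q"
      using q by (simp add: field_simps)
    then have "\<bar>real c * \<alpha> - of_int a / real q\<bar> = \<bar>real q * (real c * \<alpha>) - of_int a\<bar> / real q"
      by (simp only: abs_divide abs_of_nat)
    also have "\<dots> \<le> (1 / real P) / real q" using ak(4) q by (intro divide_right_mono) auto
    finally show ?thesis by (simp add: mult.commute)
  qed
  show thesis
  proof
    have "1 / (real q * real P) \<le> 1 / (real q * real q)"
      using q P by (intro divide_left_mono mult_left_mono mult_pos_pos) auto
    then show "\<bar>real c * \<alpha> - of_int a / real q\<bar> \<le> 1 / (real q)\<^sup>2"
      using dist by (simp add: power2_eq_square)
    show "real q \<le> 2 * real N / Q" using q P2 by simp
    show "Q < real c * real q"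
    proof (rule ccontr)
      assume "\<not> Q < real c * real q"
      then have le: "real (c * q) \<le> Q" by simp
      have "\<alpha> - of_int a / real (c * q) = (real c * \<alpha> - of_int a / real q) / real c"
        using assms q by (simp add: field_simps)
      then have "\<bar>\<alpha> - of_int a / real (c * q)\<bar> = \<bar>real c * \<alpha> - of_int a / real q\<bar> / real c"
        by (simp only: abs_divide abs_of_nat)
      also have "\<dots> \<le> \<bar>real c * \<alpha> - of_int a / real q\<bar> / 1"
        using assms by (intro divide_left_mono) auto
      also have "\<dots> \<le> 1 / (real q * real P)" using dist by simp
      also have "\<dots> \<le> 1 / (1 * (real N / Q))"
        using q P NQ by (intro divide_left_mono mult_mono mult_pos_pos) auto
      also have "\<dots> = Q / real N" by simp
      finally have "\<alpha> \<in> major_arcs Q N"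
        using assms q le by (intro rational_near_in_major_arcs[of \<alpha> "c * q" Q a]) (auto simp: minor_arcs_def)
      then show False using assms by (simp add: minor_arcs_def)
    qed
  qed (use q ak in auto)
qed

text \<open>With U = ceil Q, between Q and 2 Q, every term of \<open>exp_sum_mangoldt_bound\<close>
  is at most a constant times \<open>D * L ^ 4\<close>. The condition on \<open>N\<close> supplies
  in particular \<open>U * U \<le> X\<close> and \<open>Q\<^sup>2 \<le> D\<close>.\<close>

lemma exp_sum_minor_arc_bound:
  fixes \<alpha> Q :: real and N c :: nat
  assumes \<alpha>: "\<alpha> \<in> minor_arcs Q N" and c: "0 < c" and Q: "1 \<le> Q" and N: "8 * real c * Q ^ 3 \<le> real N"
  shows "norm (exp_sum c N \<alpha>) \<le> (1344 * real c + 6464) * ln (real N) ^ 4 * (real N / sqrt Q)"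
proof -
  \<comment> \<open>Doubling gives ln (2 N) \<le> L, which covers both 2 X and q \<le> 2 N / Q. The
    resulting factor 16 turns 84 and 404 into 1344 and 6464.\<close>
  define L where "L = 2 * ln (real N)"
  define X where "X = N div c"
  define U where "U = nat \<lceil>Q\<rceil>"
  define D where "D = real N / sqrt Q"
  have Q3: "1 \<le> Q ^ 2" "Q \<le> Q ^ 2" "Q ^ 2 \<le> Q ^ 3" "1 \<le> Q ^ 3" "Q \<le> Q ^ 3"
    using Q power_increasing[of 1 2 Q] power_increasing[of 2 3 Q] power_increasing[of 1 3 Q] by auto
  have c1: "1 \<le> real c" using c by simp
  have cQ3: "Q ^ 3 \<le> real c * Q ^ 3" using mult_right_mono[OF c1, of "Q ^ 3"] Q by simp
  have NQ3: "8 * Q ^ 3 \<le> real N" using N cQ3 by linarith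
  then have N8: "8 \<le> real N" using Q3 by linarith
  have QN: "Q \<le> real N" using NQ3 Q3 by linarith
  have N0: "0 < N" using N8 by simp
  obtain a :: int and q :: nat where aq: "0 < q" "coprime a (int q)"
    "\<bar>real c * \<alpha> - of_int a / real q\<bar> \<le> 1 / (real q)\<^sup>2" "Q < real c * real q" "real q \<le> 2 * real N / Q"
    using minor_arc_approximation[OF \<alpha> c N0 Q QN] by blast
  have "Q \<le> real U" unfolding U_def by linarith
  moreover have "real U \<le> 2 * Q" using Q unfolding U_def by linarith
  ultimately have U: "Q \<le> real U" "real U \<le> 2 * Q" by simp_all
  then have U1: "1 \<le> U" using Q by linarith
  have L1: "1 \<le> L"
  proof -
    have "ln (exp 1) \<le> ln (real N)"
      using N8 exp_le by (subst ln_le_cancel_iff) auto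
    then show ?thesis by (simp add: L_def)
  qed
  have ln2N: "ln (2 * real N) \<le> L"
  proof -
    have "ln 2 \<le> ln (real N)" using N8 by (subst ln_le_cancel_iff) auto
    then show ?thesis using N8 by (simp add: L_def ln_mult)
  qed
  have XN: "real X \<le> real N" by (simp add: X_def)
  have UU: "U * U \<le> X"
  proof -
    have "real U * real U \<le> (2 * Q) * (2 * Q)" using U Q by (intro mult_mono) auto
    also have "\<dots> = 4 * Q ^ 2" by (simp add: power2_eq_square)
    finally have "real (U * U) * real c \<le> 4 * Q ^ 2 * real c" using c by simp
    also have "\<dots> \<le> 8 * real c * Q ^ 3"
    proof -
      have "real c * Q ^ 2 \<le> real c * Q ^ 3" using Q3 by (intro mult_left_mono) auto
      moreover have "0 \<le> real c * Q ^ 3" using Q by simp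
      ultimately show ?thesis by simp
    qed
    also have "\<dots> \<le> real N" by (rule N)
    finally have "real (U * U * c) \<le> real N" by (simp only: of_nat_mult)
    then show ?thesis using c by (simp add: X_def less_eq_div_iff_mult_less_eq del: of_nat_mult)
  qed
  have "U * 1 \<le> U * U" using U1 by (intro mult_left_mono) auto
  then have X1: "1 \<le> X" using U1 UU by linarith
  have lnq: "ln (real q) \<le> L"
  proof -
    have "2 * real N / Q \<le> 2 * real N / 1" using Q by (intro divide_left_mono) auto
    then have "ln (real q) \<le> ln (2 * real N)" using aq by (subst ln_le_cancel_iff) auto
    then show ?thesis using ln2N by simp
  qed
  have lnX: "ln (2 * real X) \<le> L"
  proof -
    have "ln (2 * real X) \<le> ln (2 * real N)" using XN X1 by (subst ln_le_cancel_iff) auto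
    then show ?thesis using ln2N by simp
  qed
  have sQ: "1 \<le> sqrt Q" "sqrt Q \<le> Q" "sqrt Q * sqrt Q = Q"
    using Q real_sqrt_le_mono[of Q "Q\<^sup>2"] Q3 by auto
  have D: "real N / Q \<le> D" unfolding D_def using sQ Q by (intro divide_left_mono) auto
  have D0: "0 \<le> D" using Q by (simp add: D_def)
  have Q2D: "Q\<^sup>2 \<le> D"
  proof -
    have "Q\<^sup>2 * sqrt Q \<le> Q\<^sup>2 * Q" using sQ by (intro mult_left_mono) auto
    also have "\<dots> \<le> real N" using NQ3 Q3 by (simp add: power2_eq_square power3_eq_cube)
    finally show ?thesis using sQ by (simp add: D_def field_simps)
  qed
  have b1: "real X / real q \<le> real c * D"
  proof -
    have "real X / real q \<le> real N / (Q / real c)"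
      using XN aq c Q by (intro frac_le) (auto simp: field_simps)
    also have "\<dots> = real c * (real N / Q)" by (simp add: field_simps)
    finally show ?thesis using mult_left_mono[OF D, of "real c"] by linarith
  qed
  have b2: "real q \<le> 2 * D" using aq(5) D by simp
  have b3: "real U \<le> 2 * D" using U Q2D Q3 by linarith
  have b4: "(real U)\<^sup>2 \<le> 4 * D"
  proof -
    have "(real U)\<^sup>2 \<le> (2 * Q)\<^sup>2" using U by (intro power_mono) auto
    then show ?thesis using Q2D by simp
  qed
  have b5: "sqrt (real X * (real X / real q + 3 * real X / real U + real q)) \<le> (real c + 5) * D"
  proof -
    have "real X / real q \<le> real N / (Q / real c)"
      using XN aq c Q by (intro frac_le) (auto simp: field_simps)
    then have 1: "real X / real q \<le> real c * (real N / Q)" by (simp add: field_simps)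
    have "real X / real U \<le> real N / Q" using XN U Q by (intro frac_le) auto
    then have 2: "3 * real X / real U \<le> 3 * (real N / Q)" by simp
    have 3: "real q \<le> 2 * (real N / Q)" using aq(5) by simp
    have "real X / real q + 3 * real X / real U + real q
        \<le> real c * (real N / Q) + 3 * (real N / Q) + 2 * (real N / Q)"
      by (intro add_mono 1 2 3)
    also have "\<dots> = (real c + 5) * (real N / Q)" by (simp add: algebra_simps)
    \<comment> \<open>Squaring a factor that is at least 1 makes the root below exact.\<close>
    also have "\<dots> \<le> (real c + 5)\<^sup>2 * (real N / Q)"
      using Q c1 by (intro mult_right_mono) (auto simp: power2_eq_square)
    finally have "real X * (real X / real q + 3 * real X / real U + real q)
        \<le> real N * ((real c + 5)\<^sup>2 * (real N / Q))"
      using XN by (intro mult_mono) auto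
    also have "\<dots> = ((real c + 5) * D)\<^sup>2"
      using sQ Q by (simp add: D_def power2_eq_square power_mult_distrib)
    finally have "sqrt (real X * (real X / real q + 3 * real X / real U + real q)) \<le> sqrt (((real c + 5) * D)\<^sup>2)"
      by (rule real_sqrt_le_mono)
    then show ?thesis using D0 by simp
  qed
  have L4: "L \<le> L ^ 4" "L\<^sup>2 \<le> L ^ 4"
    using L1 power_increasing[of 1 4 L] power_increasing[of 2 4 L] by auto
  have "norm (exp_sum c N \<alpha>) \<le> real U * L
      + 40 * L\<^sup>2 * (real X / real q + real U + real q)
      + 20 * L\<^sup>2 * (real X / real q + (real U)\<^sup>2 + real q)
      + 24 * L ^ 4 * sqrt (real X * (real X / real q + 3 * real X / real U + real q))"
    unfolding exp_sum_eq[OF c] X_def[symmetric]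
    by (rule exp_sum_mangoldt_bound[OF aq(1-3) L1 lnq lnX U1 UU])
  also have "\<dots> \<le> (2 * D) * L ^ 4
      + 40 * L ^ 4 * (real c * D + 2 * D + 2 * D)
      + 20 * L ^ 4 * (real c * D + 4 * D + 2 * D)
      + 24 * L ^ 4 * ((real c + 5) * D)"
  proof (intro add_mono)
    have L0: "0 \<le> L\<^sup>2" "0 \<le> L ^ 4" using L1 by auto
    show "real U * L \<le> (2 * D) * L ^ 4"
      using b3 L4(1) L1 D0 by (intro mult_mono) auto
    have "real X / real q + real U + real q \<le> real c * D + 2 * D + 2 * D"
      by (intro add_mono b1 b2 b3)
    then show "40 * L\<^sup>2 * (real X / real q + real U + real q) \<le> 40 * L ^ 4 * (real c * D + 2 * D + 2 * D)"
      using L4(2) L0 by (intro mult_mono[of "40 * L\<^sup>2"]) auto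
    have "real X / real q + (real U)\<^sup>2 + real q \<le> real c * D + 4 * D + 2 * D"
      by (intro add_mono b1 b2 b4)
    then show "20 * L\<^sup>2 * (real X / real q + (real U)\<^sup>2 + real q) \<le> 20 * L ^ 4 * (real c * D + 4 * D + 2 * D)"
      using L4(2) L0 by (intro mult_mono[of "20 * L\<^sup>2"]) auto
    show "24 * L ^ 4 * sqrt (real X * (real X / real q + 3 * real X / real U + real q))
        \<le> 24 * L ^ 4 * ((real c + 5) * D)"
      using L0 by (intro mult_left_mono b5) auto
  qed
  also have "\<dots> = (84 * real c + 402) * L ^ 4 * D" by (simp add: algebra_simps)
  also have "\<dots> \<le> (84 * real c + 404) * L ^ 4 * D"
    using D0 L1 by (intro mult_right_mono) auto
  also have "\<dots> = (1344 * real c + 6464) * ln (real N) ^ 4 * D"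
    by (simp add: L_def power_mult_distrib algebra_simps)
  finally show ?thesis unfolding D_def .
qed

lemma norm_exp_sum_le:
  assumes "0 < b"
  shows "norm (exp_sum b N \<alpha>) \<le> 6 * (real N / real b)"
proof -
  have "norm (exp_sum b N \<alpha>) \<le> (\<Sum>n=1..N div b. mangoldt n)"
    unfolding exp_sum_eq[OF assms] by (rule sum_norm_le) (simp add: norm_mult)
  also have "\<dots> \<le> 6 * real (N div b)" by (rule sum_mangoldt_le)
  also have "\<dots> \<le> 6 * (real N / real b)" by (intro mult_left_mono of_nat_div_le_of_nat) auto
  finally show ?thesis .
qed

section \<open>Mean square over the circle\<close>

lemma has_integral_additive_char:
  "((\<lambda>x. additive_char (of_int j * x)) has_integral (if j = 0 then 1 else 0)) {0..1}"
proof (cases "j = 0")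
  case True
  then show ?thesis using has_integral_const_real[of "1 :: complex" 0 1] by simp
next
  case False
  define k where "k = 2 * of_real pi * \<i> * complex_of_int j"
  have k: "k \<noteq> 0" using False by (simp add: k_def)
  have eq: "additive_char (of_int j * x) = exp (k * of_real x)" for x
    by (simp add: additive_char_def k_def mult_ac)
  have "((\<lambda>x. exp (k * of_real x)) has_integral (exp (k * of_real 1) / k - exp (k * of_real 0) / k)) {0..1}"
  proof (rule fundamental_theorem_of_calculus)
    fix x :: real
    have "((\<lambda>z. exp (k * z) / k) has_field_derivative exp (k * of_real x)) (at (of_real x))"
      using k by (auto intro!: derivative_eq_intros)
    then show "((\<lambda>x. exp (k * of_real x) / k) has_vector_derivative exp (k * of_real x)) (at x within {0..1})"
      by (rule has_vector_derivative_real_field)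
  qed auto
  moreover have "exp (k * of_real 1) = 1"
    using eq[of 1] by simp
  ultimately show ?thesis using False by (simp add: eq)
qed

text \<open>Orthogonality leaves \<open>b * n = b * k\<close>, which is the diagonal as
  \<open>b\<close> is positive. Both factors there are at most ln N; these are the two logarithms
  that join the four of the pointwise bound.\<close>

lemma integral_norm_exp_sum_squared:
  assumes "0 < b" "1 \<le> N"
  shows "(LINT \<alpha>:{0..1}|lborel. (norm (exp_sum b N \<alpha>))\<^sup>2) \<le> real N * (ln (real N))\<^sup>2"
proof -
  define X where "X = N div b"
  have "set_integrable lborel {0..1} (\<lambda>\<alpha>. (norm (exp_sum b N \<alpha>))\<^sup>2)"
    unfolding set_integrable_def
    by (intro borel_integrable_compact continuous_intros compact_Icc)
  then have eq: "(LINT \<alpha>:{0..1}|lborel. (norm (exp_sum b N \<alpha>))\<^sup>2) = integral {0..1} (\<lambda>\<alpha>. (norm (exp_sum b N \<alpha>))\<^sup>2)"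
    by (rule set_borel_integral_eq_integral(2))
  have expand: "complex_of_real ((norm (exp_sum b N \<alpha>))\<^sup>2)
      = (\<Sum>n=1..X. \<Sum>k=1..X. mangoldt n * mangoldt k * additive_char (of_int (int (b * n) - int (b * k)) * \<alpha>))" for \<alpha>
  proof -
    have *: "mangoldt n * additive_char (real n * (real b * \<alpha>)) * cnj (mangoldt k * additive_char (real k * (real b * \<alpha>)))
        = mangoldt n * mangoldt k * additive_char (of_int (int (b * n) - int (b * k)) * \<alpha>)" for n k
    proof -
      have "cnj (mangoldt k) = mangoldt k" by (simp add: complex_eq_iff)
      moreover have "additive_char (of_int (int (b * n) - int (b * k)) * \<alpha>)
          = additive_char (real n * (real b * \<alpha>)) * additive_char (- (real k * (real b * \<alpha>)))"
        unfolding additive_char_add[symmetric] by (simp add: algebra_simps)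
      ultimately show ?thesis by (simp add: cnj_additive_char)
    qed
    show ?thesis
      unfolding complex_norm_square exp_sum_eq[OF assms(1)] X_def[symmetric] cnj_sum sum_product
      by (intro sum.cong refl *)
  qed
  have "((\<lambda>\<alpha>. complex_of_real ((norm (exp_sum b N \<alpha>))\<^sup>2)) has_integral
      (\<Sum>n=1..X. \<Sum>k=1..X. mangoldt n * mangoldt k * (if int (b * n) - int (b * k) = 0 then 1 else 0))) {0..1}"
    unfolding expand
    by (intro has_integral_sum has_integral_mult_right has_integral_additive_char) auto
  also have "(\<Sum>n=1..X. \<Sum>k=1..X. mangoldt n * mangoldt k * (if int (b * n) - int (b * k) = 0 then 1 else 0))
      = (\<Sum>n=1..X. \<Sum>k=1..X. if n = k then mangoldt n * mangoldt n else 0 :: complex)"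
    using assms by (intro sum.cong) auto
  also have "\<dots> = (\<Sum>n=1..X. mangoldt n * mangoldt n)" by simp
  also have "\<dots> = of_real (\<Sum>n=1..X. (mangoldt n)\<^sup>2)" by (simp add: power2_eq_square)
  finally have "((\<lambda>\<alpha>. (norm (exp_sum b N \<alpha>))\<^sup>2) has_integral (\<Sum>n=1..X. (mangoldt n)\<^sup>2)) {0..1}"
    by (drule_tac has_integral_Re) (simp only: Re_complex_of_real)
  then have "(LINT \<alpha>:{0..1}|lborel. (norm (exp_sum b N \<alpha>))\<^sup>2) = (\<Sum>n=1..X. (mangoldt n)\<^sup>2)"
    unfolding eq by (rule integral_unique)
  also have "\<dots> \<le> (\<Sum>n=1..X. (ln (real N))\<^sup>2)"
  proof (intro sum_mono power_mono)
    fix n assume n: "n \<in> {1..X}"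
    have "X \<le> N" by (simp add: X_def)
    then have "ln (real n) \<le> ln (real N)" using n by (subst ln_le_cancel_iff) auto
    then show "mangoldt n \<le> ln (real N)" using mangoldt_le[of n] n by simp
  qed (simp add: mangoldt_nonneg)
  also have "\<dots> = real X * (ln (real N))\<^sup>2" by simp
  also have "\<dots> \<le> real N * (ln (real N))\<^sup>2" by (intro mult_right_mono) (auto simp: X_def)
  finally show ?thesis .
qed

section \<open>Assembling the minor arc integral\<close>

lemma prod_split_first_three:
  fixes f :: "nat \<Rightarrow> 'a :: comm_monoid_mult"
  assumes "3 \<le> m"
  shows "(\<Prod>i=1..m. f i) = f 1 * f 2 * f 3 * (\<Prod>i=4..m. f i)"
proof -
  have "{1..m} = insert 1 (insert 2 (insert 3 {4..m}))" using assms by auto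
  then show ?thesis by (simp add: mult.assoc)
qed

text \<open>Only \<open>E\<close> exploits the minor arcs. The arithmetic-geometric inequality
  decouples the second and third factors, after which the nonnegative majorant can be integrated
  over the whole circle, where Parseval applies.\<close>

lemma minor_arc_integral_bound:
  fixes b :: "nat \<Rightarrow> nat" and Q E :: real
  assumes m: "3 \<le> m" and N: "1 \<le> N" and b: "\<And>i. i \<in> {1..m} \<Longrightarrow> 0 < b i"
    and E: "0 \<le> E" "\<And>\<alpha>. \<alpha> \<in> minor_arcs Q N \<Longrightarrow> norm (exp_sum (b 1) N \<alpha>) \<le> E"
  shows "norm (LINT \<alpha>:minor_arcs Q N|lborel.
      (\<Prod>i=1..m. exp_sum (b i) N \<alpha>) * additive_char (- real N * \<alpha>))
    \<le> E * (\<Prod>i=4..m. 6 * (real N / real (b i))) * (real N * (ln (real N))\<^sup>2)"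
proof -
  define R where "R = (\<Prod>i=4..m. 6 * (real N / real (b i)))"
  define g where "g \<alpha> = E * R / 2 * ((norm (exp_sum (b 2) N \<alpha>))\<^sup>2 + (norm (exp_sum (b 3) N \<alpha>))\<^sup>2)" for \<alpha>
  have R0: "0 \<le> R" unfolding R_def by (intro prod_nonneg) auto
  have b23: "0 < b 2" "0 < b 3" using b m by auto
  have sub: "minor_arcs Q N \<subseteq> {0..1}" by (auto simp: minor_arcs_def)
  have sq_int: "set_integrable lborel {0..1} (\<lambda>\<alpha>. (norm (exp_sum c N \<alpha>))\<^sup>2)" for c
    unfolding set_integrable_def by (intro borel_integrable_compact continuous_intros compact_Icc)
  have g_int: "set_integrable lborel {0..1} g"
    unfolding g_def by (intro set_integrable_mult_right set_integral_add(1) sq_int)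
  have g_int': "set_integrable lborel (minor_arcs Q N) g"
    by (rule set_integrable_subset[OF g_int]) (use sub minor_arcs_measurable in auto)
  have g0: "0 \<le> g \<alpha>" for \<alpha> using E R0 by (simp add: g_def)
  have pointwise: "norm ((\<Prod>i=1..m. exp_sum (b i) N \<alpha>) * additive_char (- real N * \<alpha>)) \<le> g \<alpha>"
    if "\<alpha> \<in> minor_arcs Q N" for \<alpha>
  proof -
    let ?S = "\<lambda>i. norm (exp_sum (b i) N \<alpha>)"
    have "norm ((\<Prod>i=1..m. exp_sum (b i) N \<alpha>) * additive_char (- real N * \<alpha>)) = (\<Prod>i=1..m. ?S i)"
      by (simp add: norm_mult prod_norm)
    also have "\<dots> = ?S 1 * ?S 2 * ?S 3 * (\<Prod>i=4..m. ?S i)" by (rule prod_split_first_three[OF m])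
    also have "\<dots> = (?S 1 * (\<Prod>i=4..m. ?S i)) * (?S 2 * ?S 3)" by (simp add: mult_ac)
    also have "\<dots> \<le> (E * R) * (((?S 2)\<^sup>2 + (?S 3)\<^sup>2) / 2)"
    proof (rule mult_mono)
      have "(\<Prod>i=4..m. ?S i) \<le> R"
        unfolding R_def by (intro prod_mono conjI norm_exp_sum_le b) auto
      then show "?S 1 * (\<Prod>i=4..m. ?S i) \<le> E * R"
        using E that by (intro mult_mono) (auto intro: prod_nonneg)
      show "?S 2 * ?S 3 \<le> ((?S 2)\<^sup>2 + (?S 3)\<^sup>2) / 2"
        using sum_squares_bound[of "?S 2" "?S 3"] by simp
    qed (use E R0 in auto)
    finally show ?thesis by (simp add: g_def)
  qed
  have "norm (LINT \<alpha>:minor_arcs Q N|lborel. (\<Prod>i=1..m. exp_sum (b i) N \<alpha>) * additive_char (- real N * \<alpha>))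
      \<le> (LINT \<alpha>:minor_arcs Q N|lborel. norm ((\<Prod>i=1..m. exp_sum (b i) N \<alpha>) * additive_char (- real N * \<alpha>)))"
    by (rule set_integral_norm_bound[OF minor_arc_integrand_integrable])
  also have "\<dots> \<le> (LINT \<alpha>:minor_arcs Q N|lborel. g \<alpha>)"
    by (rule set_integral_mono[OF set_integrable_norm[OF minor_arc_integrand_integrable] g_int' pointwise])
  also have "\<dots> \<le> (LINT \<alpha>:{0..1}|lborel. g \<alpha>)"
    unfolding set_lebesgue_integral_def
  proof (rule integral_mono)
    show "indicator (minor_arcs Q N) \<alpha> *\<^sub>R g \<alpha> \<le> indicator {0..1} \<alpha> *\<^sub>R g \<alpha>" for \<alpha>
      using sub g0[of \<alpha>] by (auto simp: indicator_def)
  qed (use g_int g_int' in \<open>auto simp: set_integrable_def\<close>)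
  also have "\<dots> = E * R / 2 * ((LINT \<alpha>:{0..1}|lborel. (norm (exp_sum (b 2) N \<alpha>))\<^sup>2)
      + (LINT \<alpha>:{0..1}|lborel. (norm (exp_sum (b 3) N \<alpha>))\<^sup>2))"
    unfolding g_def by (simp add: set_integral_add(2)[OF sq_int sq_int])
  also have "\<dots> \<le> E * R / 2 * (real N * (ln (real N))\<^sup>2 + real N * (ln (real N))\<^sup>2)"
    using E R0 N b23 by (intro mult_left_mono add_mono integral_norm_exp_sum_squared) auto
  also have "\<dots> = E * R * (real N * (ln (real N))\<^sup>2)" by simp
  finally show ?thesis unfolding R_def .
qed

theorem theorem3p5:
  fixes m :: nat and B \<delta> :: real and c :: "nat \<Rightarrow> nat"
  assumes "m \<ge> 3" and "B > 0"
    and "\<And>i. i \<in> {1..m} \<Longrightarrow> c i > 0"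
    and "0 < \<delta>" and "\<delta> < 1 / (12 * real m)"
  shows "\<exists>C::real. \<exists>N0::nat. \<forall>N\<ge>N0. \<forall>(b :: nat \<Rightarrow> nat) (\<eta> :: nat \<Rightarrow> nat) (Q :: real).
     Q = ln (real N) powr B \<longrightarrow>
     (\<forall>i\<in>{1..m}. b i > 0 \<and> real (b i) \<le> real N powr \<delta>) \<longrightarrow>
     (\<forall>i\<in>{1..m}. \<eta> i > 0 \<and> b i = c i * \<eta> i) \<longrightarrow>
     (\<forall>i\<in>{1..m}. \<forall>p. prime p \<and> p dvd \<eta> i \<longrightarrow> real p > Q) \<longrightarrow>
     Gcd (b ` {1..m}) = 1 \<longrightarrow>
     \<eta> 1 = 1 \<and> \<eta> 2 = 1 \<and> \<eta> 3 = 1 \<longrightarrow>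
     norm (LINT \<alpha>:minor_arcs Q N|lborel.
             (\<Prod>i=1..m. exp_sum (b i) N \<alpha>) * additive_char (- real N * \<alpha>))
       \<le> C * (1 / (\<Prod>i=1..m. real (b i)) *
              (real N ^ (m - 1) / ln (real N) powr (B / 2 - 6)))"
proof -
  define K where "K = 1344 * real (c 1) + 6464"
  \<comment> \<open>The power of 6 is Chebyshev's constant for the factors from the fourth on. The
    product of the \<open>c i\<close> restores 1/(b_1 b_2 b_3), which the bounds for the first three
    factors do not produce; there b_i = c_i, so \<open>C\<close> is independent of \<open>N\<close>
    and \<eta>.\<close>
  define C where "C = K * 6 ^ (m - 3) * (real (c 1) * real (c 2) * real (c 3))"
  have K0: "0 \<le> K" by (simp add: K_def)
  \<comment> \<open>Powers of log N are eventually below \<open>N\<close>; the threshold depends on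
    \<open>c 1\<close> and \<open>B\<close> only and is fixed before \<open>b\<close> and
    \<eta>.\<close>
  have "eventually (\<lambda>N. 8 * real (c 1) * (ln (real N) powr B) ^ 3 \<le> real N) sequentially"
    using \<open>B > 0\<close> assms(3)[of 1] \<open>m \<ge> 3\<close> by real_asymp
  then obtain N1 where N1: "\<And>N. N \<ge> N1 \<Longrightarrow> 8 * real (c 1) * (ln (real N) powr B) ^ 3 \<le> real N"
    by (auto simp: eventually_sequentially)
  show ?thesis
  \<comment> \<open>As 3 exceeds e, this threshold also ensures ln N \<ge> 1 and hence Q \<ge>
    1.\<close>
  proof (intro exI[of _ C] exI[of _ "max 3 N1"] allI impI)
    fix N :: nat and b \<eta> :: "nat \<Rightarrow> nat" and Q :: real
    assume N: "max 3 N1 \<le> N" and Q: "Q = ln (real N) powr B"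
      and b: "\<forall>i\<in>{1..m}. b i > 0 \<and> real (b i) \<le> real N powr \<delta>"
      and \<eta>: "\<forall>i\<in>{1..m}. \<eta> i > 0 \<and> b i = c i * \<eta> i" and \<eta>1: "\<eta> 1 = 1 \<and> \<eta> 2 = 1 \<and> \<eta> 3 = 1"
    have bc: "b 1 = c 1" "b 2 = c 2" "b 3 = c 3" using \<eta> \<eta>1 \<open>m \<ge> 3\<close> by auto
    have b0: "0 < b i" if "i \<in> {1..m}" for i using b that by blast
    have c0: "0 < c 1" "0 < c 2" "0 < c 3" using assms(3) \<open>m \<ge> 3\<close> by auto
    define l where "l = ln (real N)"
    have l1: "1 \<le> l"
    proof -
      have "ln (exp 1) \<le> ln (real N)" using N exp_le by (subst ln_le_cancel_iff) auto
      then show ?thesis by (simp add: l_def)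
    qed
    have Q1: "1 \<le> Q" unfolding Q l_def[symmetric] using l1 \<open>B > 0\<close> by (simp add: ge_one_powr_ge_zero)
    have sqrtQ: "sqrt Q = l powr (B / 2)"
      using l1 by (simp add: Q l_def[symmetric] powr_half_sqrt[symmetric] powr_powr)
    define P where "P = (\<Prod>i=4..m. real (b i))"
    have P0: "0 < P" unfolding P_def using b0 by (intro prod_pos) auto
    have R: "(\<Prod>i=4..m. 6 * (real N / real (b i))) = 6 ^ (m - 3) * real N ^ (m - 3) / P"
      by (simp add: P_def prod.distrib prod_dividef)
    have "norm (LINT \<alpha>:minor_arcs Q N|lborel.
             (\<Prod>i=1..m. exp_sum (b i) N \<alpha>) * additive_char (- real N * \<alpha>))
       \<le> (K * l ^ 4 * (real N / sqrt Q)) * (\<Prod>i=4..m. 6 * (real N / real (b i))) * (real N * l\<^sup>2)"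
      unfolding l_def
    proof (rule minor_arc_integral_bound)
      show "0 \<le> K * ln (real N) ^ 4 * (real N / sqrt Q)" using K0 Q1 by simp
      show "norm (exp_sum (b 1) N \<alpha>) \<le> K * ln (real N) ^ 4 * (real N / sqrt Q)"
        if "\<alpha> \<in> minor_arcs Q N" for \<alpha>
        unfolding bc K_def using that c0 Q1 N1[of N] N
        by (intro exp_sum_minor_arc_bound) (auto simp: Q)
    qed (use b0 N \<open>m \<ge> 3\<close> in auto)
    also have "\<dots> = K * 6 ^ (m - 3) * (l ^ 6 / l powr (B / 2)) * (real N ^ (m - 3) * (real N)\<^sup>2) / P"
      unfolding R sqrtQ by (simp add: field_simps eval_nat_numeral)
    also have "real N ^ (m - 3) * (real N)\<^sup>2 = real N ^ (m - 1)"
    proof -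
      have "m - 1 = (m - 3) + 2" using \<open>m \<ge> 3\<close> by simp
      then show ?thesis by (simp only: power_add)
    qed
    also have "l ^ 6 / l powr (B / 2) = 1 / l powr (B / 2 - 6)"
      using l1 by (simp add: powr_diff powr_realpow)
    also have "K * 6 ^ (m - 3) * (1 / l powr (B / 2 - 6)) * real N ^ (m - 1) / P
        = C * (1 / (real (c 1) * real (c 2) * real (c 3) * P) * (real N ^ (m - 1) / l powr (B / 2 - 6)))"
      using c0 P0 by (simp add: C_def mult_ac)
    also have "real (c 1) * real (c 2) * real (c 3) * P = (\<Prod>i=1..m. real (b i))"
      unfolding P_def prod_split_first_three[OF \<open>m \<ge> 3\<close>] bc ..
    finally show "norm (LINT \<alpha>:minor_arcs Q N|lborel.
             (\<Prod>i=1..m. exp_sum (b i) N \<alpha>) * additive_char (- real N * \<alpha>))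
       \<le> C * (1 / (\<Prod>i=1..m. real (b i)) *
              (real N ^ (m - 1) / ln (real N) powr (B / 2 - 6)))"
      unfolding l_def .
  qed
qed

end
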